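(* For all integers $n\ge 3$, $m\ge 2$, $k\ge 1$, one has $H_k(n,m)\le (km)^{n-1}$.
   Context: Perturbed system: $$\dot{x}_1=\sum_{j=1}^k a_j\varepsilon^j x_1-\Big(b+\sum_{j=1}^k b_j\varepsilon^j\Big)x_2+\sum_{i_1+\cdots+i_n=m}p_{1,i_1,\ldots,i_n}x_1^{i_1}\cdots x_n^{i_n},$$ $$\dot{x}_2=\Big(b+\sum_{j=1}^k b_j\varepsilon^j\Big)x_1+\sum_{j=1}^k a_j\varepsilon^j x_2+\sum_{i_1+\cdots+i_n=m}p_{2,i_1,\ldots,i_n}x_1^{i_1}\cdots x_n^{i_n},$$ $$\dot{x}_s=\sum_{j=1}^k c_{s,j}\varepsilon^j x_s+\sum_{i_1+\cdots+i_n=m}p_{s,i_1,\ldots,i_n}x_1^{i_1}\cdots x_n^{i_n},\quad s=3,\ldots,n,$$ with $p_{s,i_1,\ldots,i_n}=\sum_{j=1}^k\varepsilon^{j-1}p_{s,i_1,\ldots,i_n,j-1}$; here $b\ne 0$, $a_j,b_j,c_{s,j},p_{s,i_1,\ldots,i_n,j-1}$ are real parameters and $\varepsilon$ is the perturbation parameter. Standard form: after the changes $x_1=r\cos\theta$, $x_2=r\sin\theta$ ($r>0$), taking $\theta$ as independent variable, and $(r,x_3,\ldots,x_n)=\varepsilon^{1/(m-1)}(R,X_3,\ldots,X_n)$, the system becomes $$\frac{dR}{d\theta}=\frac{R\sum_{i=1}^k\varepsilon^iS_{i,1}}{bR+\sum_{i=1}^k\varepsilon^iS_{i,2}}=\sum_{i=1}^k\varepsilon^iF_{i,1}+\mathcal{O}(\varepsilon^{k+1}),\qquad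 \frac{dX_s}{d\theta}=\frac{R\sum_{i=1}^k\varepsilon^iS_{i,s}}{bR+\sum_{i=1}^k\varepsilon^iS_{i,2}}=\sum_{i=1}^k\varepsilon^iF_{i,s}+\mathcal{O}(\varepsilon^{k+1}),\quad s=3,\ldots,n,$$ where the $F_{i,j}(\theta,R,X_3,\ldots,X_n)$ are the Taylor coefficients in $\varepsilon$ at $\varepsilon=0$, and, with sums over $i_1+\cdots+i_n=m$, $$S_{i,1}=a_iR+\sum(p_{1,i_1,\ldots,i_n,i-1}\cos\theta+p_{2,i_1,\ldots,i_n,i-1}\sin\theta)(R\cos\theta)^{i_1}(R\sin\theta)^{i_2}X_3^{i_3}\cdots X_n^{i_n},$$ $$S_{i,2}=b_iR+\sum(p_{2,i_1,\ldots,i_n,i-1}\cos\theta-p_{1,i_1,\ldots,i_n,i-1}\sin\theta)(R\cos\theta)^{i_1}(R\sin\theta)^{i_2}X_3^{i_3}\cdots X_n^{i_n},$$ $$S_{i,s}=c_{s,i}X_s+\sum p_{s,i_1,\ldots,i_n,i-1}(R\cos\theta)^{i_1}(R\sin\theta)^{i_2}X_3^{i_3}\cdots X_n^{i_n},\quad s=3,\ldots,n.$$ Averaged functions: put $\boldsymbol{\eta}=(R,X_3,\ldots,X_n)$, $\boldsymbol{F}_i=(F_{i,1},F_{i,3},\ldots,F_{i,n})$ and define recursively $\boldsymbol{y}_1(\theta,\boldsymbol{\eta})=\int_0^\theta\boldsymbol{F}_1(\tau,\boldsymbol{\eta})\,d\tau$ and $$\boldsymbol{y}_i(\theta,\boldsymbol{\eta})=i!\int_0^\theta\Big(\boldsymbol{F}_i(\tau,\boldsymbol{\eta})+\sum_{\ell=1}^{i-1}\sum_{S_\ell}\frac{1}{\beta_1!\,\beta_2!\,2!^{\beta_2}\cdots\beta_\ell!\,\ell!^{\beta_\ell}}\,\partial^L\boldsymbol{F}_{i-\ell}(\tau,\boldsymbol{\eta})\bigodot_{j=1}^{\ell}\boldsymbol{y}_j(\tau,\boldsymbol{\eta})^{\beta_j}\Big)d\tau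 ,$$ where $S_\ell$ is the set of $\ell$-tuples $[\beta_1,\ldots,\beta_\ell]$ of nonnegative integers with $\beta_1+2\beta_2+\cdots+\ell\beta_\ell=\ell$, $L=\beta_1+\cdots+\beta_\ell$, $\partial^L\boldsymbol{F}$ is the $L$th Fréchet derivative (symmetric $L$-multilinear map) with respect to $\boldsymbol{\eta}$, applied to the list in which each $\boldsymbol{y}_j$ appears $\beta_j$ times. The $i$th-order averaged function is $\boldsymbol{f}_i(\boldsymbol{\eta})=\boldsymbol{y}_i(2\pi,\boldsymbol{\eta})/i!$. $H_k(n,m)$ denotes the maximum number of limit cycles bifurcating from the origin that can be detected by the $k$th-order averaging method, i.e. the maximum, over all real parameter values with $b\neq 0$ for which $\boldsymbol{f}_1\equiv\cdots\equiv\boldsymbol{f}_{k-1}\equiv 0$ and $\boldsymbol{f}_k\not\equiv 0$, of the number of simple real zeros $\boldsymbol{\eta}^*$ of $\boldsymbol{f}_k$ with $R>0$ (simple: $\boldsymbol{f}_k(\boldsymbol{\eta}^* )=0$ and $\det J_{\boldsymbol{f}_k}(\boldsymbol{\eta}^* )\neq 0$). Each such zero yields, for $\varepsilon>0$ small, a limit cycle by the averaging theorem. *)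

theory Defs
  imports "HOL-Analysis.Analysis" "HOL-Library.Extended_Nat"
begin

text \<open>
  The phase space has coordinates \<open>x\<^sub>1, x\<^sub>2\<close> and \<open>x\<^sub>s\<close> for \<open>s\<close> in a finite index type \<open>'s\<close>
  that plays the role of \<open>{3, \<dots>, n}\<close>; thus \<open>n = CARD('s) + 2\<close>, and since types are
  nonempty every \<open>n \<ge> 3\<close> (and no other) arises.
  A monomial \<open>x\<^sub>1^i1 * x\<^sub>2^i2 * (\<Prod>s. x\<^sub>s^(e s))\<close> is given by its exponents \<open>(i1, i2, e)\<close>.
\<close>

type_synonym 's expo = "nat \<times> nat \<times> ('s \<Rightarrow> nat)"

text \<open>
  Parameters of the perturbed system: \<open>par_a P j\<close>, \<open>par_bs P j\<close>, \<open>par_c P s j\<close> are the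
  coefficients of \<open>\<epsilon>^j\<close> (\<open>1 \<le> j \<le> k\<close>) in the linear part; the last argument of \<open>par_p1\<close>,
  \<open>par_p2\<close>, \<open>par_ps\<close> is likewise the power of \<open>\<epsilon>\<close>, ranging over \<open>0, \<dots>, k - 1\<close>.
  Entries outside these ranges, or with exponents of total degree other than \<open>m\<close>, are never used.
\<close>

record 's params =
  par_b :: real
  par_a :: "nat \<Rightarrow> real"
  par_bs :: "nat \<Rightarrow> real"
  par_c :: "'s \<Rightarrow> nat \<Rightarrow> real"
  par_p1 :: "'s expo \<Rightarrow> nat \<Rightarrow> real"
  par_p2 :: "'s expo \<Rightarrow> nat \<Rightarrow> real"
  par_ps :: "'s \<Rightarrow> 's expo \<Rightarrow> nat \<Rightarrow> real"

definition expos :: "nat \<Rightarrow> 's::finite expo set" where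
  "expos m = {(i1, i2, e). i1 + i2 + (\<Sum>s\<in>UNIV. e s) = m}"

text \<open>
  The averaged variable \<open>\<eta> = (R, X\<^sub>3, \<dots>, X\<^sub>n)\<close> is a vector indexed by \<open>'s option\<close>:
  component \<open>None\<close> is \<open>R\<close>, component \<open>Some s\<close> is \<open>X\<^sub>s\<close>.
\<close>

definition cyl_monom :: "'s::finite expo \<Rightarrow> real \<Rightarrow> real ^ ('s option) \<Rightarrow> real" where
  "cyl_monom = (\<lambda>(i1, i2, e) \<theta> \<eta>.
     (\<eta> $ None * cos \<theta>) ^ i1 * (\<eta> $ None * sin \<theta>) ^ i2 * (\<Prod>s\<in>UNIV. (\<eta> $ Some s) ^ e s))"

definition S1 :: "'s::finite params \<Rightarrow> nat \<Rightarrow> nat \<Rightarrow> real \<Rightarrow> real ^ ('s option) \<Rightarrow> real" where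
  "S1 P m i \<theta> \<eta> = par_a P i * \<eta> $ None
     + (\<Sum>e\<in>expos m. (par_p1 P e (i - 1) * cos \<theta> + par_p2 P e (i - 1) * sin \<theta>) * cyl_monom e \<theta> \<eta>)"

definition S2 :: "'s::finite params \<Rightarrow> nat \<Rightarrow> nat \<Rightarrow> real \<Rightarrow> real ^ ('s option) \<Rightarrow> real" where
  "S2 P m i \<theta> \<eta> = par_bs P i * \<eta> $ None
     + (\<Sum>e\<in>expos m. (par_p2 P e (i - 1) * cos \<theta> - par_p1 P e (i - 1) * sin \<theta>) * cyl_monom e \<theta> \<eta>)"

definition Ss :: "'s::finite params \<Rightarrow> nat \<Rightarrow> 's \<Rightarrow> nat \<Rightarrow> real \<Rightarrow> real ^ ('s option) \<Rightarrow> real" where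
  "Ss P m s i \<theta> \<eta> = par_c P s i * \<eta> $ Some s
     + (\<Sum>e\<in>expos m. par_ps P s e (i - 1) * cyl_monom e \<theta> \<eta>)"

text \<open>The right-hand side of the rescaled system for \<open>d\<eta>/d\<theta>\<close>, used for \<open>R > 0\<close>.\<close>

definition std_rhs ::
  "'s::finite params \<Rightarrow> nat \<Rightarrow> nat \<Rightarrow> real \<Rightarrow> real \<Rightarrow> real ^ ('s option) \<Rightarrow> real ^ ('s option)" where
  "std_rhs P m k \<epsilon> \<theta> \<eta> = (\<chi> j.
     \<eta> $ None * (\<Sum>i=1..k. \<epsilon> ^ i * (case j of None \<Rightarrow> S1 P m i \<theta> \<eta> | Some s \<Rightarrow> Ss P m s i \<theta> \<eta>))
     / (par_b P * \<eta> $ None + (\<Sum>i=1..k. \<epsilon> ^ i * S2 P m i \<theta> \<eta>)))"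

definition std_F ::
  "'s::finite params \<Rightarrow> nat \<Rightarrow> nat \<Rightarrow> nat \<Rightarrow> real \<Rightarrow> real ^ ('s option) \<Rightarrow> real ^ ('s option)" where
  "std_F P m k i \<theta> \<eta> = (\<chi> j. (deriv ^^ i) (\<lambda>\<epsilon>. std_rhs P m k \<epsilon> \<theta> \<eta> $ j) 0 / fact i)"

text \<open>
  \<open>iter_frechet f [v\<^sub>1, \<dots>, v\<^sub>L] x\<close> is the \<open>L\<close>th Frechet derivative of \<open>f\<close> at \<open>x\<close> applied to
  \<open>v\<^sub>1, \<dots>, v\<^sub>L\<close>. The list form is used because the type of the \<open>L\<close>th derivative as an iterated
  linear map depends on \<open>L\<close>; it has this meaning where \<open>f\<close> is smooth near \<open>x\<close>.
\<close>

primrec iter_frechet ::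
  "('a::real_normed_vector \<Rightarrow> 'b::real_normed_vector) \<Rightarrow> 'a list \<Rightarrow> 'a \<Rightarrow> 'b" where
  "iter_frechet f [] = f"
| "iter_frechet f (v # vs) = (\<lambda>x. frechet_derivative (iter_frechet f vs) (at x) v)"

text \<open>Tuples \<open>[\<beta>\<^sub>1, \<dots>, \<beta>\<^sub>l]\<close> are encoded as functions vanishing outside \<open>{1..l}\<close>.\<close>

definition avg_tuples :: "nat \<Rightarrow> (nat \<Rightarrow> nat) set" where
  "avg_tuples l = {\<beta>. (\<forall>j. j \<notin> {1..l} \<longrightarrow> \<beta> j = 0) \<and> (\<Sum>j=1..l. j * \<beta> j) = l}"

text \<open>Meaningful for \<open>i \<ge> 1\<close> and \<open>\<theta> \<ge> 0\<close>; for \<open>i = 1\<close> the sum over \<open>l\<close> is empty.\<close>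

function avg_y ::
  "(nat \<Rightarrow> real \<Rightarrow> 'a::euclidean_space \<Rightarrow> 'a) \<Rightarrow> nat \<Rightarrow> real \<Rightarrow> 'a \<Rightarrow> 'a" where
  "avg_y F i \<theta> \<eta> = fact i *\<^sub>R integral {0..\<theta>} (\<lambda>\<tau>. F i \<tau> \<eta> +
     (\<Sum>l\<in>{1..i - 1}. \<Sum>\<beta>\<in>avg_tuples l.
        (1 / (\<Prod>j=1..l. fact (\<beta> j) * fact j ^ \<beta> j)) *\<^sub>R
        iter_frechet (F (i - l) \<tau>)
          (concat (map (\<lambda>j. replicate (\<beta> j) (avg_y F j \<tau> \<eta>)) [1..<Suc l])) \<eta>))"
  by pat_completeness auto
termination
  by (relation "Wellfounded.measure (\<lambda>(F, i, \<theta>, \<eta>). i)") auto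

declare avg_y.simps [simp del]

definition avg_f ::
  "'s::finite params \<Rightarrow> nat \<Rightarrow> nat \<Rightarrow> nat \<Rightarrow> real ^ ('s option) \<Rightarrow> real ^ ('s option)" where
  "avg_f P m k i \<eta> = avg_y (std_F P m k) i (2 * pi) \<eta> /\<^sub>R fact i"

definition avg_admissible :: "nat \<Rightarrow> nat \<Rightarrow> 's::finite params \<Rightarrow> bool" where
  "avg_admissible m k P \<longleftrightarrow> par_b P \<noteq> 0
     \<and> (\<forall>i\<in>{1..<k}. \<forall>\<eta>. \<eta> $ None > 0 \<longrightarrow> avg_f P m k i \<eta> = 0)
     \<and> (\<exists>\<eta>. \<eta> $ None > 0 \<and> avg_f P m k k \<eta> \<noteq> 0)"

definition simple_zeros :: "nat \<Rightarrow> nat \<Rightarrow> 's::finite params \<Rightarrow> (real ^ ('s option)) set" where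
  "simple_zeros m k P = {\<eta>. \<eta> $ None > 0 \<and> avg_f P m k k \<eta> = 0
     \<and> det (jacobian (avg_f P m k k) (at \<eta>)) \<noteq> 0}"

definition enat_card :: "'a set \<Rightarrow> enat" where
  "enat_card A = (if finite A then enat (card A) else \<infinity>)"

text \<open>
  \<open>H\<^sub>k(n,m)\<close> with \<open>n = CARD('s) + 2\<close>. The supremum is taken in \<open>enat\<close>, so that a bound by a
  natural number includes finiteness of every set of simple zeros; it is then a maximum.
\<close>

definition H_avg :: "'s::finite itself \<Rightarrow> nat \<Rightarrow> nat \<Rightarrow> enat" where
  "H_avg _ m k = (SUP P \<in> {P :: 's params. avg_admissible m k P}. enat_card (simple_zeros m k P))"

end

theory Submission
  imports Defs
begin

text \<open>
  By induction on \<open>i\<close>, each component of \<open>F\<^sub>i\<close> and of \<open>y\<^sub>i\<close> is, for \<open>R > 0\<close>, a polynomial in \<open>\<eta>\<close> of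
  degree at most \<open>i * m\<close>, with coefficients continuous in \<open>\<theta>\<close>, divided by \<open>R^(i - 1)\<close>. Hence the
  simple zeros of \<open>f\<^sub>k\<close> are nondegenerate zeros of \<open>n - 1\<close> polynomials \<open>g\<^sub>i\<close> of degree at most
  \<open>d = k * m\<close> in \<open>n - 1\<close> variables, and a Bezout bound for nondegenerate real zeros remains.

  For that bound suppose there were \<open>d^N + 1\<close> such zeros, \<open>N\<close> being the number of variables. They
  persist as zeros of \<open>g\<^sub>i + t * x\<^sub>i^d\<close> for all small \<open>t > 0\<close>. As there are only \<open>d^N\<close>
  monomials with all exponents below \<open>d\<close>, some nonzero combination \<open>u\<^sub>t\<close> of the evaluations at these
  zeros kills all of them. Reducing the other monomials by \<open>g\<^sub>i + t * x\<^sub>i^d = 0\<close> shows that \<open>u\<^sub>t\<close>,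
  restricted to polynomials of bounded degree, is an eigenvector with eigenvalue \<open>t\<close> of a linear map
  independent of \<open>t\<close>. A finite-dimensional space does not admit infinitely many eigenvalues.
\<close>

section \<open>A Bezout bound for nondegenerate real zeros\<close>

lemma has_derivative_vec_lambda:
  fixes f :: "'o::finite \<Rightarrow> 'a::real_normed_vector \<Rightarrow> real"
  assumes "\<And>i. (f i has_derivative f' i) F"
  shows "((\<lambda>x. \<chi> i. f i x) has_derivative (\<lambda>v. \<chi> i. f' i v)) F"
proof -
  have "((\<lambda>x. \<Sum>i\<in>UNIV. f i x *\<^sub>R axis i 1) has_derivative (\<lambda>v. \<Sum>i\<in>UNIV. f' i v *\<^sub>R axis i (1::real))) F"
    using assms by (intro has_derivative_sum has_derivative_scaleR_left)
  moreover have "(\<Sum>i\<in>UNIV. g i *\<^sub>R axis i 1) = (\<chi> i. g i)" for g :: "'o \<Rightarrow> real"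
    by (simp add: vec_eq_iff axis_def if_distrib[of "\<lambda>y. _ * y"] sum.delta' cong: if_cong)
  ultimately show ?thesis by simp
qed

text \<open>Gaussian elimination, by induction on the equations: an equation with nonzero
  coefficient at \<open>y\<close> is solved for the unknown at \<open>y\<close>, and subtracting
  multiples of it removes \<open>y\<close> from the others. Equations and unknowns both decrease by
  one.\<close>

lemma homogeneous_system_nontrivial_solution:
  fixes a :: "'b \<Rightarrow> 'a \<Rightarrow> real"
  assumes "finite B" "finite A" "card B < card A"
  shows "\<exists>c. (\<exists>x\<in>A. c x \<noteq> 0) \<and> (\<forall>b\<in>B. (\<Sum>x\<in>A. c x * a b x) = 0)"
  using assms
proof (induction B arbitrary: A a rule: finite_induct)
  case empty
  then obtain x where "x \<in> A" by fastforce
  then show ?case by (intro exI[of _ "\<lambda>_. 1"]) auto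
next
  case (insert b B)
  show ?case
  proof (cases "\<forall>x\<in>A. a b x = 0")
    case True
    have "card B < card A" using insert by simp
    from insert.IH[OF insert.prems(1) this, of a]
    obtain c where "\<exists>x\<in>A. c x \<noteq> 0" "\<forall>b\<in>B. (\<Sum>x\<in>A. c x * a b x) = 0" by blast
    then show ?thesis using True by (intro exI[of _ c]) simp
  next
    case False
    then obtain y where y: "y \<in> A" "a b y \<noteq> 0" by blast
    define A' where "A' = A - {y}"
    define a' where "a' = (\<lambda>b' x. a b' x - a b' y * a b x / a b y)"
    have A': "finite A'" "card B < card A'"
      using insert y by (auto simp: A'_def)
    obtain c x where c: "x \<in> A'" "c x \<noteq> 0" "\<And>b'. b' \<in> B \<Longrightarrow> (\<Sum>x\<in>A'. c x * a' b' x) = 0"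
      using insert.IH[OF A', of a'] by blast
    define c' where "c' = c(y := - (\<Sum>x\<in>A'. c x * a b x) / a b y)"
    have sumA: "(\<Sum>x\<in>A. c' x * a b' x)
        = (\<Sum>x\<in>A'. c x * a b' x) - (\<Sum>x\<in>A'. c x * a b x) / a b y * a b' y" for b'
    proof -
      have "(\<Sum>x\<in>A. c' x * a b' x) = c' y * a b' y + (\<Sum>x\<in>A'. c' x * a b' x)"
        using y insert.prems by (simp add: A'_def sum.remove)
      also have "(\<Sum>x\<in>A'. c' x * a b' x) = (\<Sum>x\<in>A'. c x * a b' x)"
        by (rule sum.cong) (auto simp: c'_def A'_def)
      finally show ?thesis by (simp add: c'_def)
    qed
    have "(\<Sum>x\<in>A. c' x * a b' x) = 0" if "b' \<in> insert b B" for b'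
    proof (cases "b' = b")
      case True
      then show ?thesis using y by (simp add: sumA)
    next
      case False
      then have "(\<Sum>x\<in>A'. c x * a' b' x) = 0" using that c by blast
      then show ?thesis
        by (simp add: sumA a'_def right_diff_distrib sum_subtractf sum_distrib_left
            sum_divide_distrib sum_distrib_right algebra_simps)
    qed
    moreover have "x \<in> A" "c' x \<noteq> 0" using c by (auto simp: c'_def A'_def)
    ultimately show ?thesis by blast
  qed
qed

text \<open>The hypothesis \<open>eig\<close> replaces an explicit linear map: relations among the
  vectors \<open>u t\<close> on \<open>E\<close> survive multiplying each vector by its
  \<open>t\<close>, which says that sending \<open>u t\<close> to \<open>t * u t\<close> is well
  defined on their span. The induction runs over a set \<open>T\<close> that contains the support of
  the relation.\<close>

lemma eigenvectors_independent:
  fixes u :: "real \<Rightarrow> 'e \<Rightarrow> real"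
  assumes "finite S"
    and nz: "\<And>t. t \<in> S \<Longrightarrow> \<exists>e\<in>E. u t e \<noteq> 0"
    and eig: "\<And>c e. e \<in> E \<Longrightarrow> (\<forall>e'\<in>E. (\<Sum>t\<in>S. c t * u t e') = 0) \<Longrightarrow> (\<Sum>t\<in>S. c t * (t * u t e)) = 0"
    and "\<And>e. e \<in> E \<Longrightarrow> (\<Sum>t\<in>S. c t * u t e) = 0"
    and "t \<in> S"
  shows "c t = 0"
proof -
  have "\<forall>t\<in>T. c t = 0" if "finite T" "T \<subseteq> S" "\<forall>t\<in>S - T. c t = 0" "\<forall>e\<in>E. (\<Sum>t\<in>S. c t * u t e) = 0" for T c
    using that
  proof (induction T arbitrary: c rule: finite_induct)
    case (insert s T)
    \<comment> \<open>Applying "map minus s" to the relation kills the term at \<open>s\<close> and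
      scales the term at \<open>t\<close> by \<open>t - s\<close>, which is nonzero on
      \<open>T\<close>.\<close>
    have "\<forall>t\<in>T. c t * (t - s) = 0"
    proof (rule insert.IH)
      show "\<forall>t\<in>S - T. c t * (t - s) = 0" using insert.prems by force
      show "\<forall>e\<in>E. (\<Sum>t\<in>S. c t * (t - s) * u t e) = 0"
      proof
        fix e assume "e \<in> E"
        have "(\<Sum>t\<in>S. c t * (t - s) * u t e)
          = (\<Sum>t\<in>S. c t * (t * u t e)) - s * (\<Sum>t\<in>S. c t * u t e)"
          by (simp add: algebra_simps sum_subtractf sum_distrib_left)
        then show "(\<Sum>t\<in>S. c t * (t - s) * u t e) = 0"
          using eig[OF \<open>e \<in> E\<close>] insert.prems \<open>e \<in> E\<close> by simp
      qed
    qed (use insert.prems in auto)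
    then have T0: "\<forall>t\<in>T. c t = 0" using insert.hyps by auto
    have "s \<in> S" using insert.prems by blast
    then obtain e where e: "e \<in> E" "u s e \<noteq> 0" using nz by blast
    have "(\<Sum>t\<in>S. c t * u t e) = c s * u s e"
      using T0 insert.prems \<open>finite S\<close> \<open>s \<in> S\<close>
      by (subst sum.remove[of _ s]) (auto intro!: sum.neutral)
    then show ?case using T0 e insert.prems by auto
  qed auto
  from this[of S c] show ?thesis using assms by auto
qed

section \<open>Monomials and polynomials in several variables\<close>

definition monom_at :: "('o::finite \<Rightarrow> nat) \<Rightarrow> real ^ 'o \<Rightarrow> real" where
  "monom_at \<alpha> x = (\<Prod>i\<in>UNIV. x $ i ^ \<alpha> i)"

lemma monom_at_add: "monom_at (\<lambda>i. \<alpha> i + \<beta> i) x = monom_at \<alpha> x * monom_at \<beta> x"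
  by (simp add: monom_at_def power_add prod.distrib)

lemma monom_at_zero: "monom_at (\<lambda>i. 0) x = 1"
  by (simp add: monom_at_def)

lemma monom_at_single: "monom_at (\<lambda>i. if i = j then d else 0) x = x $ j ^ d"
  by (simp add: monom_at_def if_distrib[of "\<lambda>n. _ ^ n"] prod.delta cong: if_cong)

text \<open>Exponents may occur repeatedly in the list, so addition is concatenation and
  multiplication by a coordinate acts entry by entry.\<close>

definition mpoly_degree_le :: "nat \<Rightarrow> (real \<times> ('o::finite \<Rightarrow> nat)) list \<Rightarrow> bool" where
  "mpoly_degree_le d L \<longleftrightarrow> (\<forall>(a, \<alpha>)\<in>set L. (\<Sum>i\<in>UNIV. \<alpha> i) \<le> d)"

definition mpeval :: "(real \<times> ('o::finite \<Rightarrow> nat)) list \<Rightarrow> real ^ 'o \<Rightarrow> real" where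
  "mpeval L x = (\<Sum>(a, \<alpha>)\<leftarrow>L. a * monom_at \<alpha> x)"

lemma finite_exponents: "finite {\<alpha> :: 'o::finite \<Rightarrow> nat. (\<Sum>i\<in>UNIV. \<alpha> i) \<le> D}"
proof (rule finite_subset)
  show "{\<alpha> :: 'o \<Rightarrow> nat. (\<Sum>i\<in>UNIV. \<alpha> i) \<le> D} \<subseteq> PiE UNIV (\<lambda>_. {..D})"
  proof (intro subsetI PiE_I)
    fix \<alpha> :: "'o \<Rightarrow> nat" and i assume "\<alpha> \<in> {\<alpha>. (\<Sum>i\<in>UNIV. \<alpha> i) \<le> D}"
    then show "\<alpha> i \<in> {..D}" using member_le_sum[of i UNIV \<alpha>] by simp
  qed auto
qed (auto intro: finite_PiE)

lemma card_reduced_exponents: "card {\<alpha> :: 'o::finite \<Rightarrow> nat. \<forall>i. \<alpha> i < d} = d ^ CARD('o)"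
proof -
  have "{\<alpha> :: 'o \<Rightarrow> nat. \<forall>i. \<alpha> i < d} = PiE UNIV (\<lambda>_. {..<d})" by auto
  then show ?thesis by (simp add: card_PiE)
qed

lemma finite_reduced_exponents: "finite {\<alpha> :: 'o::finite \<Rightarrow> nat. \<forall>i. \<alpha> i < d}"
proof -
  have "{\<alpha> :: 'o \<Rightarrow> nat. \<forall>i. \<alpha> i < d} = PiE UNIV (\<lambda>_. {..<d})" by auto
  then show ?thesis by (auto intro: finite_PiE)
qed

text \<open>Evaluations at distinct points are linearly independent on polynomials of degree at most
  \<open>card Z\<close>: for each other point \<open>w\<close> take a factor
  \<open>x $ i - w $ i\<close> with a coordinate \<open>i\<close> in which \<open>z\<close> and
  \<open>w\<close> differ. The product vanishes on \<open>Z\<close> except at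
  \<open>z\<close>.\<close>

lemma separating_functional_nonzero:
  fixes c :: "real ^ 'o::finite \<Rightarrow> real"
  assumes "finite Z" "z \<in> Z" "c z \<noteq> 0"
  shows "\<exists>\<alpha>. (\<Sum>i\<in>UNIV. \<alpha> i) \<le> card Z \<and> (\<Sum>z\<in>Z. c z * monom_at \<alpha> z) \<noteq> 0"
proof (rule ccontr)
  assume "\<not> ?thesis"
  then have vanish: "(\<Sum>z\<in>Z. c z * monom_at \<alpha> z) = 0" if "(\<Sum>i\<in>UNIV. \<alpha> i) \<le> card Z" for \<alpha>
    using that by blast
  \<comment> \<open>\<open>g\<close> is the product of the factors for \<open>W\<close>. The last
    clause tracks its degree \<open>card W\<close> indirectly: times a monomial of degree at most
    \<open>card Z - card W\<close>, it stays among the polynomials that the functional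
    kills.\<close>
  have *: "\<exists>g. g z \<noteq> 0 \<and> (\<forall>w\<in>W. g w = 0) \<and>
      (\<forall>\<alpha>. (\<Sum>i\<in>UNIV. \<alpha> i) + card W \<le> card Z \<longrightarrow> (\<Sum>z\<in>Z. c z * (g z * monom_at \<alpha> z)) = 0)"
    if "finite W" "z \<notin> W" for W
    using that
  proof (induction W rule: finite_induct)
    case empty
    then show ?case using vanish by (intro exI[of _ "\<lambda>_. 1"]) auto
  next
    case (insert w W)
    then obtain g where g: "g z \<noteq> 0" "\<forall>w\<in>W. g w = 0"
      "\<And>\<alpha>. (\<Sum>i\<in>UNIV. \<alpha> i) + card W \<le> card Z \<Longrightarrow> (\<Sum>z\<in>Z. c z * (g z * monom_at \<alpha> z)) = 0"
      by blast
    from insert.prems obtain i where i: "z $ i \<noteq> w $ i" by (metis insertI1 vec_eq_iff)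
    show ?case
    proof (intro exI[of _ "\<lambda>x. (x $ i - w $ i) * g x"] conjI allI impI)
      fix \<alpha> :: "'o \<Rightarrow> nat" assume deg: "(\<Sum>i\<in>UNIV. \<alpha> i) + card (insert w W) \<le> card Z"
      define \<alpha>' where "\<alpha>' = (\<lambda>j. (if j = i then 1 else 0) + \<alpha> j)"
      have m: "monom_at \<alpha>' x = x $ i * monom_at \<alpha> x" for x
        using monom_at_add[of "\<lambda>j. if j = i then 1 else 0" \<alpha> x] monom_at_single[of i 1 x]
        by (simp add: \<alpha>'_def)
      have d: "(\<Sum>i\<in>UNIV. \<alpha>' i) = Suc (\<Sum>i\<in>UNIV. \<alpha> i)"
        by (simp add: \<alpha>'_def sum.distrib sum.delta)
      have "(\<Sum>z\<in>Z. c z * ((z $ i - w $ i) * g z * monom_at \<alpha> z))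
        = (\<Sum>z\<in>Z. c z * (g z * monom_at \<alpha>' z)) - w $ i * (\<Sum>z\<in>Z. c z * (g z * monom_at \<alpha> z))"
        by (simp add: m algebra_simps sum_subtractf sum_distrib_left)
      also have "\<dots> = 0" using g(3)[of \<alpha>'] g(3)[of \<alpha>] deg d insert.hyps by simp
      finally show "(\<Sum>z\<in>Z. c z * ((z $ i - w $ i) * g z * monom_at \<alpha> z)) = 0" .
    qed (use g i in auto)
  qed
  obtain g where g: "g z \<noteq> 0" "\<forall>w\<in>Z - {z}. g w = 0"
    "\<And>\<alpha>. (\<Sum>i\<in>UNIV. \<alpha> i) + card (Z - {z}) \<le> card Z \<Longrightarrow> (\<Sum>z\<in>Z. c z * (g z * monom_at \<alpha> z)) = 0"
    using *[of "Z - {z}"] assms by auto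
  have "(\<Sum>z\<in>Z. c z * (g z * monom_at (\<lambda>i. 0) z)) = c z * g z"
    using assms g by (subst sum.remove[of _ z]) (auto simp: monom_at_zero intro!: sum.neutral)
  moreover have "(\<Sum>z\<in>Z. c z * (g z * monom_at (\<lambda>i. 0) z)) = 0"
    using assms by (intro g(3)) (simp add: card_Diff_singleton)
  ultimately show False using g assms by simp
qed

section \<open>The eigenvalue argument\<close>

text \<open>\<open>u \<alpha>\<close> is the value at the monomial \<open>\<alpha>\<close> of a
  combination of evaluations at the points of \<open>Z\<close>. There is one point more than there
  are monomials with all exponents below \<open>d\<close>, so the combination can be chosen to kill
  these. The last clause is the eigenvector equation, and the degree bound in the first is
  \<open>card Z\<close>.\<close>

lemma mpeval_perturbed_eigen:
  fixes f :: "'o::finite \<Rightarrow> (real \<times> ('o \<Rightarrow> nat)) list"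
  assumes Z: "finite Z" "card Z = Suc (d ^ CARD('o))"
    and zero: "\<And>z i. z \<in> Z \<Longrightarrow> mpeval (f i) z + t * z $ i ^ d = 0"
  shows "\<exists>u. (\<exists>\<alpha>. (\<Sum>i\<in>UNIV. \<alpha> i) \<le> Suc (d ^ CARD('o)) \<and> u \<alpha> \<noteq> 0)
    \<and> (\<forall>\<alpha>. (\<forall>i. \<alpha> i < d) \<longrightarrow> u \<alpha> = 0)
    \<and> (\<forall>\<alpha> i. d \<le> \<alpha> i \<longrightarrow>
        t * u \<alpha> = - (\<Sum>(a, \<beta>)\<leftarrow>f i. a * u (\<lambda>j. \<beta> j + (\<alpha> j - (if j = i then d else 0)))))"
proof -
  obtain c z where c: "z \<in> Z" "c z \<noteq> 0"
    "\<And>\<alpha>. \<forall>i. \<alpha> i < d \<Longrightarrow> (\<Sum>z\<in>Z. c z * monom_at \<alpha> z) = 0"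
    using homogeneous_system_nontrivial_solution[OF finite_reduced_exponents Z(1), of d monom_at]
    by (auto simp: card_reduced_exponents Z)
  define u where "u = (\<lambda>\<alpha>. \<Sum>z\<in>Z. c z * monom_at \<alpha> z)"
  have "t * u \<alpha> = - (\<Sum>(a, \<beta>)\<leftarrow>f i. a * u (\<lambda>j. \<beta> j + (\<alpha> j - (if j = i then d else 0))))"
    if "d \<le> \<alpha> i" for \<alpha> i
  proof -
    \<comment> \<open>\<open>\<gamma>\<close> is the exponent of the cofactor of
      \<open>z $ i ^ d\<close> in the monomial \<open>\<alpha>\<close>; since
      \<open>d \<le> \<alpha> i\<close>, the subtraction of naturals is exact.\<close>
    define \<gamma> where "\<gamma> = (\<lambda>j. \<alpha> j - (if j = i then d else 0))"
    have lin: "(\<Sum>(a, \<beta>)\<leftarrow>L. a * u (\<lambda>j. \<beta> j + \<gamma> j)) = (\<Sum>z\<in>Z. c z * (mpeval L z * monom_at \<gamma> z))" for L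
    proof (induction L)
      case (Cons p L)
      obtain a \<beta> where p: "p = (a, \<beta>)" by fastforce
      show ?case
        using Cons by (simp add: p mpeval_def u_def monom_at_add sum_distrib_left sum.distrib algebra_simps)
    qed (simp add: mpeval_def)
    have "\<alpha> = (\<lambda>j. (if j = i then d else 0) + \<gamma> j)" using that by (auto simp: \<gamma>_def)
    then have "monom_at \<alpha> z = z $ i ^ d * monom_at \<gamma> z" for z
      by (metis monom_at_add monom_at_single)
    then have "t * u \<alpha> = (\<Sum>z\<in>Z. c z * (t * z $ i ^ d * monom_at \<gamma> z))"
      by (simp add: u_def sum_distrib_left algebra_simps)
    also have "\<dots> = (\<Sum>z\<in>Z. - (c z * (mpeval (f i) z * monom_at \<gamma> z)))"
    proof (rule sum.cong[OF refl])
      fix z assume "z \<in> Z"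
      then have "t * z $ i ^ d = - mpeval (f i) z" using zero[of z i] by linarith
      then show "c z * (t * z $ i ^ d * monom_at \<gamma> z) = - (c z * (mpeval (f i) z * monom_at \<gamma> z))" by simp
    qed
    also have "\<dots> = - (\<Sum>(a, \<beta>)\<leftarrow>f i. a * u (\<lambda>j. \<beta> j + \<gamma> j))"
      by (simp add: lin sum_negf)
    finally show ?thesis by (simp add: \<gamma>_def)
  qed
  then show ?thesis
    using separating_functional_nonzero[of Z z c] Z c by (intro exI[of _ u]) (auto simp: u_def)
qed

text \<open>The equations for \<open>t * u t \<alpha>\<close> have coefficients that do not depend
  on \<open>t\<close>, and they stay inside the finite set \<open>E\<close> of exponents because
  trading \<open>x $ i ^ d\<close> for terms of \<open>f i\<close> does not raise the degree. So the
  \<open>u t\<close> are eigenvectors of one map on a space of dimension \<open>card E\<close>, with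
  more eigenvalues than that.\<close>

lemma mpeval_perturbed_few_zeros:
  fixes f :: "'o::finite \<Rightarrow> (real \<times> ('o \<Rightarrow> nat)) list"
  assumes deg: "\<And>i. mpoly_degree_le d (f i)" and inf: "infinite T"
    and Z: "\<And>t. t \<in> T \<Longrightarrow> finite (Z t) \<and> card (Z t) = Suc (d ^ CARD('o))"
    and zero: "\<And>t z i. t \<in> T \<Longrightarrow> z \<in> Z t \<Longrightarrow> mpeval (f i) z + t * z $ i ^ d = 0"
  shows False
proof -
  define E where "E = {\<alpha> :: 'o \<Rightarrow> nat. (\<Sum>i\<in>UNIV. \<alpha> i) \<le> Suc (d ^ CARD('o))}"
  have "\<forall>t\<in>T. \<exists>u. (\<exists>\<alpha>\<in>E. u \<alpha> \<noteq> 0) \<and> (\<forall>\<alpha>. (\<forall>i. \<alpha> i < d) \<longrightarrow> u \<alpha> = 0)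
    \<and> (\<forall>\<alpha> i. d \<le> \<alpha> i \<longrightarrow>
        t * u \<alpha> = - (\<Sum>(a, \<beta>)\<leftarrow>f i. a * u (\<lambda>j. \<beta> j + (\<alpha> j - (if j = i then d else 0)))))"
    (is "\<forall>t\<in>T. ?P t")
  proof
    fix t assume "t \<in> T"
    then show "?P t" using mpeval_perturbed_eigen[of "Z t" d f t] Z zero unfolding E_def by auto
  qed
  then obtain u where u: "\<And>t. t \<in> T \<Longrightarrow> \<exists>\<alpha>\<in>E. u t \<alpha> \<noteq> 0"
    "\<And>t \<alpha>. t \<in> T \<Longrightarrow> \<forall>i. \<alpha> i < d \<Longrightarrow> u t \<alpha> = 0"
    "\<And>t \<alpha> i. t \<in> T \<Longrightarrow> d \<le> \<alpha> i \<Longrightarrow>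
      t * u t \<alpha> = - (\<Sum>(a, \<beta>)\<leftarrow>f i. a * u t (\<lambda>j. \<beta> j + (\<alpha> j - (if j = i then d else 0))))"
    unfolding bchoice_iff by blast
  obtain S where S: "S \<subseteq> T" "finite S" "card S = Suc (card E)"
    using infinite_arbitrarily_large[OF inf] by blast
  obtain c where c: "\<exists>t\<in>S. c t \<noteq> 0" "\<And>e. e \<in> E \<Longrightarrow> (\<Sum>t\<in>S. c t * u t e) = 0"
    using homogeneous_system_nontrivial_solution[of E S "\<lambda>e t. u t e"] S finite_exponents
    unfolding E_def by auto
  have "c t = 0" if "t \<in> S" for t
  proof (rule eigenvectors_independent[where E = E and u = u and S = S and c = c])
    \<comment> \<open>The hypothesis \<open>eig\<close>: at an exponent with all entries below
      \<open>d\<close> every \<open>u t\<close> vanishes; at any other, \<open>t * u t e\<close> is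
      a combination, the same for all \<open>t\<close>, of values of \<open>u t\<close> on
      \<open>E\<close>.\<close>
    fix c :: "real \<Rightarrow> real" and e assume e: "e \<in> E" and c0: "\<forall>e'\<in>E. (\<Sum>t\<in>S. c t * u t e') = 0"
    show "(\<Sum>t\<in>S. c t * (t * u t e)) = 0"
    proof (cases "\<forall>i. e i < d")
      case True
      then show ?thesis using u(2) S by (intro sum.neutral) auto
    next
      case False
      then obtain i where i: "d \<le> e i" by (auto simp: not_less)
      define sh where "sh = (\<lambda>\<beta> j. \<beta> j + (e j - (if j = i then d else 0)))"
      have sh: "sh \<beta> \<in> E" if "(\<Sum>i\<in>UNIV. \<beta> i) \<le> d" for \<beta>
      proof -
        have "(\<Sum>j\<in>UNIV. e j) = (\<Sum>j\<in>UNIV. (e j - (if j = i then d else 0)) + (if j = i then d else 0))"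
          using i by (intro sum.cong) auto
        also have "\<dots> = (\<Sum>j\<in>UNIV. (e j - (if j = i then d else 0))) + d"
          by (simp add: sum.distrib sum.delta)
        finally show ?thesis using that e by (simp add: sh_def E_def sum.distrib)
      qed
      have "(\<Sum>t\<in>S. c t * (\<Sum>(a, \<beta>)\<leftarrow>L. a * u t (sh \<beta>))) = 0" if "mpoly_degree_le d L" for L
        using that
      proof (induction L)
        case (Cons p L)
        obtain a \<beta> where p: "p = (a, \<beta>)" by fastforce
        have "(\<Sum>t\<in>S. c t * u t (sh \<beta>)) = 0" using c0 sh Cons.prems by (auto simp: mpoly_degree_le_def p)
        moreover have "(\<Sum>t\<in>S. c t * (\<Sum>(a, \<beta>)\<leftarrow>p # L. a * u t (sh \<beta>)))
          = a * (\<Sum>t\<in>S. c t * u t (sh \<beta>)) + (\<Sum>t\<in>S. c t * (\<Sum>(a, \<beta>)\<leftarrow>L. a * u t (sh \<beta>)))"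
          by (simp add: p sum.distrib sum_distrib_left algebra_simps)
        moreover have "mpoly_degree_le d L" using Cons.prems by (simp add: mpoly_degree_le_def)
        ultimately show ?case using Cons.IH by simp
      qed simp
      from this[OF deg[of i]] show ?thesis
        using u(3)[where \<alpha> = e and i = i] i S by (simp add: sh_def sum_negf subset_iff)
    qed
  qed (use u S c that in auto)
  then show False using c by blast
qed

section \<open>Persistence of nondegenerate zeros and the count\<close>

lemma continuous_on_monom_at: "continuous_on A (monom_at \<alpha>)"
  unfolding monom_at_def by (intro continuous_intros)

lemma continuous_on_mpeval: "continuous_on A (mpeval L)"
proof (induction L)
  case (Cons p L)
  obtain a \<beta> where p: "p = (a, \<beta>)" by fastforce
  have "mpeval (p # L) = (\<lambda>x. a * monom_at \<beta> x + mpeval L x)" by (auto simp: mpeval_def p)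
  then show ?case using Cons continuous_on_monom_at by (auto intro!: continuous_intros)
qed (simp add: mpeval_def[abs_def])

text \<open>An open mapping theorem, requiring a right-invertible derivative at one point only, is
  applied to \<open>(t, x)\<close> mapped to \<open>(t, G x + t *\<^sub>R h x)\<close> at
  \<open>(0, z)\<close>. The image of all \<open>t\<close> and all \<open>x\<close> in the ball
  covers a neighbourhood of \<open>(0, 0)\<close>, hence every \<open>(t, 0)\<close> with small
  \<open>t\<close>.\<close>

lemma nondegenerate_zero_persists:
  fixes G :: "real ^ 'o::finite \<Rightarrow> real ^ 'o" and h :: "real ^ 'o \<Rightarrow> real ^ 'o"
  assumes cont: "continuous_on UNIV G" "continuous_on UNIV h"
    and G: "G z = 0" "(G has_derivative G') (at z)" "inj G'" and h: "(h has_derivative h') (at z)" and "r > 0"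
  shows "\<exists>\<delta>>0. \<forall>t. \<bar>t\<bar> < \<delta> \<longrightarrow> (\<exists>x\<in>ball z r. G x + t *\<^sub>R h x = 0)"
proof -
  define \<Psi> where "\<Psi> = (\<lambda>(t, x). (t, G x + t *\<^sub>R h x))"
  have linG: "linear G'" using G has_derivative_linear by blast
  then obtain g where g: "linear g" "g \<circ> G' = id" "G' \<circ> g = id"
    using linear_injective_isomorphism[OF linG G(3)] by (auto simp: fun_eq_iff)
  have 1: "continuous_on UNIV \<Psi>"
  proof -
    have "continuous_on UNIV (\<lambda>p::real \<times> (real^'o). G (snd p))" "continuous_on UNIV (\<lambda>p::real \<times> (real^'o). h (snd p))"
      by (auto intro!: continuous_on_compose2[OF cont(1)] continuous_on_compose2[OF cont(2)] continuous_intros)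
    then show ?thesis unfolding \<Psi>_def case_prod_unfold by (intro continuous_intros)
  qed
  have 2: "(\<Psi> has_derivative (\<lambda>(s, v). (s, G' v + s *\<^sub>R h z))) (at (0, z))"
  proof -
    have "((\<lambda>p. G (snd p)) has_derivative (\<lambda>p. G' (snd p))) (at (0::real, z))"
      by (rule has_derivative_compose[OF has_derivative_snd[OF has_derivative_ident]]) (use G in simp)
    moreover have "((\<lambda>p. h (snd p)) has_derivative (\<lambda>p. h' (snd p))) (at (0::real, z))"
      by (rule has_derivative_compose[OF has_derivative_snd[OF has_derivative_ident]]) (use h in simp)
    ultimately show ?thesis
      unfolding \<Psi>_def case_prod_unfold by (auto intro!: derivative_eq_intros)
  qed
  \<comment> \<open>The inverse of the derivative of \<open>\<Psi>\<close>, which is block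
    triangular: read off \<open>s\<close>, then solve for \<open>v\<close> with the inverse
    \<open>g\<close> of \<open>G'\<close>.\<close>
  have lin: "bounded_linear (\<lambda>(s, v). (s, g (v - s *\<^sub>R h z)))"
    unfolding linear_conv_bounded_linear[symmetric] using linear_add[OF g(1)] linear_cmul[OF g(1)]
    by (intro linearI) (auto simp: linear_diff[OF g(1)] algebra_simps scaleR_add_left)
  have inv: "(\<lambda>(s, v). (s, G' v + s *\<^sub>R h z)) \<circ> (\<lambda>(s, v). (s, g (v - s *\<^sub>R h z))) = id"
    using g(3) by (auto simp: fun_eq_iff)
  have "\<Psi> (0, z) \<in> interior (\<Psi> ` (UNIV \<times> ball z r))"
    by (rule sussmann_open_mapping[OF open_UNIV 1 UNIV_I 2 lin inv])
      (use \<open>r > 0\<close> in \<open>auto simp: interior_open open_Times\<close>)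
  then obtain \<delta> where \<delta>: "\<delta> > 0" "ball (\<Psi> (0, z)) \<delta> \<subseteq> \<Psi> ` (UNIV \<times> ball z r)"
    unfolding mem_interior by blast
  have "\<exists>x\<in>ball z r. G x + t *\<^sub>R h x = 0" if "\<bar>t\<bar> < \<delta>" for t
  proof -
    have "(t, 0) \<in> ball (\<Psi> (0, z)) \<delta>" using that by (simp add: \<Psi>_def G dist_Pair_Pair)
    then have "(t, 0) \<in> \<Psi> ` (UNIV \<times> ball z r)" using \<delta> by blast
    then show ?thesis by (auto simp: \<Psi>_def)
  qed
  then show ?thesis using \<delta> by blast
qed

lemma bezout_nondegenerate_zeros:
  fixes f :: "'o::finite \<Rightarrow> (real \<times> ('o \<Rightarrow> nat)) list" and W :: "(real ^ 'o) set"
  defines "G \<equiv> \<lambda>x. \<chi> i. mpeval (f i) x"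
  assumes deg: "\<And>i. mpoly_degree_le d (f i)"
    and W: "\<And>z. z \<in> W \<Longrightarrow> G z = 0 \<and> (\<exists>G'. (G has_derivative G') (at z) \<and> inj G')"
  shows "finite W \<and> card W \<le> d ^ CARD('o)"
proof (rule ccontr)
  assume "\<not> ?thesis"
  then obtain Z where Z: "Z \<subseteq> W" "finite Z" "card Z = Suc (d ^ CARD('o))"
    by (metis not_less_eq_eq obtain_subset_with_card_n infinite_arbitrarily_large)
  define h :: "real ^ 'o \<Rightarrow> real ^ 'o" where "h = (\<lambda>x. \<chi> i. x $ i ^ d)"
  \<comment> \<open>Balls of radius \<open>r\<close> about the points of \<open>Z\<close> are
    disjoint, so the perturbed zeros remain distinct.\<close>
  obtain r where r: "r > 0" "\<And>x y. x \<in> Z \<Longrightarrow> y \<in> Z \<Longrightarrow> x \<noteq> y \<Longrightarrow> 2 * r \<le> dist x y"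
  proof -
    define Q where "Q = (\<lambda>(x, y). dist x y) ` (Z \<times> Z \<inter> {(x, y). x \<noteq> y})"
    have "finite Q" unfolding Q_def using Z by auto
    show ?thesis
    \<comment> \<open>The inserted 1 keeps the minimum defined when \<open>Z\<close> is a single
      point.\<close>
    proof (rule that[of "Min (insert 1 Q) / 2"])
      show "0 < Min (insert 1 Q) / 2" using \<open>finite Q\<close> by (auto simp: Q_def)
      fix x y assume "x \<in> Z" "y \<in> Z" "x \<noteq> y"
      then have "dist x y \<in> Q" by (force simp: Q_def)
      then show "2 * (Min (insert 1 Q) / 2) \<le> dist x y" using \<open>finite Q\<close> by simp
    qed
  qed
  have contG: "continuous_on UNIV G" unfolding G_def by (intro continuous_intros continuous_on_mpeval)
  have conth: "continuous_on UNIV h" unfolding h_def by (intro continuous_intros)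
  have derh: "\<exists>h'. (h has_derivative h') (at z)" for z
    unfolding h_def by (rule exI, rule has_derivative_vec_lambda, rule has_derivative_power,
      rule bounded_linear.has_derivative[OF bounded_linear_vec_nth], rule has_derivative_ident)
  have "\<forall>z\<in>Z. \<exists>\<delta>>0. \<forall>t. \<bar>t\<bar> < \<delta> \<longrightarrow> (\<exists>x\<in>ball z r. G x + t *\<^sub>R h x = 0)"
  proof
    fix z assume "z \<in> Z"
    then obtain G' where "G z = 0" "(G has_derivative G') (at z)" "inj G'" using W Z by blast
    then show "\<exists>\<delta>>0. \<forall>t. \<bar>t\<bar> < \<delta> \<longrightarrow> (\<exists>x\<in>ball z r. G x + t *\<^sub>R h x = 0)"
      using nondegenerate_zero_persists[OF contG conth] derh r(1) by blast
  qed
  then obtain \<delta> where \<delta>: "\<forall>z\<in>Z. \<delta> z > 0 \<and> (\<forall>t. \<bar>t\<bar> < \<delta> z \<longrightarrow> (\<exists>x\<in>ball z r. G x + t *\<^sub>R h x = 0))"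
    unfolding bchoice_iff by blast
  define \<delta>0 where "\<delta>0 = Min (insert 1 (\<delta> ` Z))"
  have \<delta>0: "\<delta>0 > 0" "\<And>z. z \<in> Z \<Longrightarrow> \<delta>0 \<le> \<delta> z" using \<delta> Z by (auto simp: \<delta>0_def)
  have "\<exists>\<zeta>. \<forall>z\<in>Z. \<zeta> z \<in> ball z r \<and> G (\<zeta> z) + t *\<^sub>R h (\<zeta> z) = 0" if "t \<in> {0<..<\<delta>0}" for t
    using \<delta> \<delta>0 that by (intro bchoice) (fastforce simp: Bex_def)
  then obtain \<zeta> where \<zeta>: "\<And>t z. t \<in> {0<..<\<delta>0} \<Longrightarrow> z \<in> Z \<Longrightarrow> dist z (\<zeta> t z) < r \<and> G (\<zeta> t z) + t *\<^sub>R h (\<zeta> t z) = 0"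
    by (metis mem_ball)
  show False
  proof (rule mpeval_perturbed_few_zeros[OF deg, where T = "{0<..<\<delta>0}" and Z = "\<lambda>t. \<zeta> t ` Z"])
    show "infinite {0<..<\<delta>0}" using \<delta>0 by simp
  next
    fix t assume t: "t \<in> {0<..<\<delta>0}"
    have "inj_on (\<zeta> t) Z"
    proof (rule inj_onI, rule ccontr)
      fix x y assume xy: "x \<in> Z" "y \<in> Z" "\<zeta> t x = \<zeta> t y" "x \<noteq> y"
      have "dist x y \<le> dist x (\<zeta> t x) + dist y (\<zeta> t y)" using xy(3) by (metis dist_triangle2)
      then show False using \<zeta>[OF t xy(1)] \<zeta>[OF t xy(2)] r(2)[OF xy(1,2,4)] by linarith
    qed
    then show "finite (\<zeta> t ` Z) \<and> card (\<zeta> t ` Z) = Suc (d ^ CARD('o))"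
      using Z by (simp add: card_image)
  next
    fix t z i assume t: "t \<in> {0<..<\<delta>0}" and "z \<in> \<zeta> t ` Z"
    then have "G z + t *\<^sub>R h z = 0" using \<zeta> by blast
    from arg_cong[OF this, of "\<lambda>v. v $ i"] show "mpeval (f i) z + t * z $ i ^ d = 0"
      by (simp add: G_def h_def)
  qed
qed

section \<open>Polynomials with continuous coefficients over powers of a coordinate\<close>

text \<open>The index \<open>d\<close> is only an upper bound for the degree in \<open>x\<close>, as
  \<open>coeff\<close> admits every \<open>d\<close>. Generating the class by coordinate
  multiplications makes closure under products, integration in \<open>t\<close> and differentiation
  in \<open>x\<close> one induction each. The interval will be \<open>{0..2 * pi}\<close>.\<close>

inductive ppoly :: "real \<Rightarrow> nat \<Rightarrow> (real \<Rightarrow> real ^ 'o::finite \<Rightarrow> real) \<Rightarrow> bool" for h where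
  coeff: "continuous_on {0..h} c \<Longrightarrow> ppoly h d (\<lambda>t x. c t)"
| add: "ppoly h d p \<Longrightarrow> ppoly h d q \<Longrightarrow> ppoly h d (\<lambda>t x. p t x + q t x)"
| coord_mult: "ppoly h d p \<Longrightarrow> ppoly h (Suc d) (\<lambda>t x. x $ i * p t x)"

lemma ppoly_mono: "ppoly h d p \<Longrightarrow> d \<le> e \<Longrightarrow> ppoly h e p"
proof (induction arbitrary: e rule: ppoly.induct)
  case (coord_mult d p i)
  then obtain e' where "e = Suc e'" "d \<le> e'" by (cases e) auto
  then show ?case using coord_mult.IH ppoly.coord_mult by blast
qed (auto intro: ppoly.intros)

lemma ppoly_coeff_mult:
  "ppoly h d p \<Longrightarrow> continuous_on {0..h} c \<Longrightarrow> ppoly h d (\<lambda>t x. c t * p t x)"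
proof (induction rule: ppoly.induct)
  case (coeff c' d)
  then show ?case by (auto intro!: ppoly.coeff continuous_intros)
next
  case (add d p q)
  then show ?case using ppoly.add by (simp add: distrib_left)
next
  case (coord_mult d p i)
  then show ?case
    using ppoly.coord_mult[of h d "\<lambda>t x. c t * p t x" i] by (simp add: mult.left_commute)
qed

lemma ppoly_mult: "ppoly h d p \<Longrightarrow> ppoly h e q \<Longrightarrow> ppoly h (d + e) (\<lambda>t x. p t x * q t x)"
proof (induction rule: ppoly.induct)
  case (coeff c d)
  then show ?case by (auto intro: ppoly_mono[OF ppoly_coeff_mult])
next
  case (add d p p')
  then show ?case using ppoly.add by (simp add: distrib_right)
next
  case (coord_mult d p i)
  then show ?case using ppoly.coord_mult[where i = i] by (simp add: mult.assoc)
qed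

lemma ppoly_sum: "(\<And>a. a \<in> A \<Longrightarrow> ppoly h d (p a)) \<Longrightarrow> ppoly h d (\<lambda>t x. \<Sum>a\<in>A. p a t x)"
  by (induction A rule: infinite_finite_induct) (auto intro: ppoly.intros)

lemma ppoly_coord: "ppoly h (Suc 0) (\<lambda>t x. x $ i)"
  using ppoly.coord_mult[OF ppoly.coeff[of h "\<lambda>_. 1" 0], of i] by simp

lemma ppoly_coord_power: "ppoly h n (\<lambda>t x. x $ i ^ n)"
  by (induction n) (auto intro!: ppoly.coeff ppoly.coord_mult)

lemma ppoly_prod:
  "finite A \<Longrightarrow> (\<And>a. a \<in> A \<Longrightarrow> ppoly h (d a) (p a)) \<Longrightarrow> ppoly h (\<Sum>a\<in>A. d a) (\<lambda>t x. \<Prod>a\<in>A. p a t x)"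
  by (induction A rule: finite_induct) (auto intro!: ppoly.coeff ppoly_mult)

lemma ppoly_continuous: "ppoly h d p \<Longrightarrow> continuous_on {0..h} (\<lambda>t. p t x)"
  by (induction rule: ppoly.induct) (auto intro!: continuous_intros)

text \<open>Coordinates do not depend on \<open>\<tau>\<close> and leave the integral, so only
  coefficients are integrated. Agreement is limited to \<open>{0..h}\<close>, where their continuity
  gives integrability and thus additivity.\<close>

lemma ppoly_integral:
  "ppoly h d p \<Longrightarrow>
    \<exists>P. ppoly h d P \<and> (\<forall>t\<in>{0..h}. \<forall>x. P t x = integral {0..t} (\<lambda>\<tau>. p \<tau> x))"
proof (induction rule: ppoly.induct)
  case (coeff c d)
  then have "ppoly h d (\<lambda>t x. integral {0..t} c)"
    by (intro ppoly.coeff indefinite_integral_continuous_1 integrable_continuous_real)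
  then show ?case by blast
next
  case (add d p q)
  then obtain P Q where PQ: "ppoly h d P" "ppoly h d Q"
    "\<forall>t\<in>{0..h}. \<forall>x. P t x = integral {0..t} (\<lambda>\<tau>. p \<tau> x)"
    "\<forall>t\<in>{0..h}. \<forall>x. Q t x = integral {0..t} (\<lambda>\<tau>. q \<tau> x)" by blast
  have "integral {0..t} (\<lambda>\<tau>. p \<tau> x + q \<tau> x) = P t x + Q t x" if t: "t \<in> {0..h}" for t x
  proof -
    have "(\<lambda>\<tau>. p \<tau> x) integrable_on {0..t}" "(\<lambda>\<tau>. q \<tau> x) integrable_on {0..t}"
      using t by (auto intro!: integrable_continuous_real continuous_on_subset[OF ppoly_continuous[OF add(1)]]
          continuous_on_subset[OF ppoly_continuous[OF add(2)]])
    then show ?thesis using PQ t by (simp add: integral_add)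
  qed
  then show ?case using ppoly.add[OF PQ(1,2)] by (intro exI conjI) auto
next
  case (coord_mult d p i)
  then obtain P where "ppoly h d P" "\<forall>t\<in>{0..h}. \<forall>x. P t x = integral {0..t} (\<lambda>\<tau>. p \<tau> x)" by blast
  then show ?case using ppoly.coord_mult[of h d P i] by (intro exI conjI) auto
qed

text \<open>A partial derivative loses one degree and the factor \<open>x $ \<rho>\<close> restores
  it. The product is what the quotient rule puts into the numerator over a power of
  \<open>x $ \<rho>\<close>, and no index \<open>d - 1\<close> arises.\<close>

lemma ppoly_derivative:
  "ppoly h d p \<Longrightarrow> \<exists>p'. (\<forall>j. ppoly h d (\<lambda>t x. x $ \<rho> * p' j t x)) \<and>
    (\<forall>t x. (p t has_derivative (\<lambda>v. \<Sum>j\<in>UNIV. v $ j * p' j t x)) (at x))"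
proof (induction rule: ppoly.induct)
  case (coeff c d)
  show ?case by (rule exI[of _ "\<lambda>j t x. 0"]) (auto intro!: ppoly.coeff)
next
  case (add d p q)
  then obtain p' q' where *: "\<And>j. ppoly h d (\<lambda>t x. x $ \<rho> * p' j t x)" "\<And>j. ppoly h d (\<lambda>t x. x $ \<rho> * q' j t x)"
    "\<And>t x. (p t has_derivative (\<lambda>v. \<Sum>j\<in>UNIV. v $ j * p' j t x)) (at x)"
    "\<And>t x. (q t has_derivative (\<lambda>v. \<Sum>j\<in>UNIV. v $ j * q' j t x)) (at x)" by blast
  show ?case
    using ppoly.add[OF *(1,2)] has_derivative_add[OF *(3,4)]
    by (intro exI[of _ "\<lambda>j t x. p' j t x + q' j t x"]) (auto simp: distrib_left sum.distrib)
next
  case (coord_mult d p i)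
  then obtain p' where *: "\<And>j. ppoly h d (\<lambda>t x. x $ \<rho> * p' j t x)"
    "\<And>t x. (p t has_derivative (\<lambda>v. \<Sum>j\<in>UNIV. v $ j * p' j t x)) (at x)" by blast
  let ?p = "\<lambda>j t x. (if j = i then p t x else 0) + x $ i * p' j t x"
  have "ppoly h (Suc d) (\<lambda>t x. x $ \<rho> * ?p j t x)" for j
  proof -
    have "ppoly h (Suc d) (\<lambda>t x. x $ \<rho> * (if j = i then p t x else 0))"
      by (cases "j = i") (auto intro!: ppoly.coeff ppoly.coord_mult coord_mult(1))
    from ppoly.add[OF this ppoly.coord_mult[OF *(1)[of j], of i]]
    show ?thesis by (simp add: algebra_simps)
  qed
  moreover have "((\<lambda>x. x $ i * p t x) has_derivative (\<lambda>v. \<Sum>j\<in>UNIV. v $ j * ?p j t x)) (at x)" for t x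
  proof -
    have "((\<lambda>x. x $ i * p t x) has_derivative
        (\<lambda>v. x $ i * (\<Sum>j\<in>UNIV. v $ j * p' j t x) + v $ i * p t x)) (at x)"
      by (intro has_derivative_mult bounded_linear.has_derivative[OF bounded_linear_vec_nth] has_derivative_ident *)
    moreover have "(\<Sum>j\<in>UNIV. v $ j * ?p j t x) = x $ i * (\<Sum>j\<in>UNIV. v $ j * p' j t x) + v $ i * p t x" for v
      by (simp add: distrib_left sum.distrib sum_distrib_left mult.left_commute
          if_distrib[of "\<lambda>y. _ * y"] sum.delta cong: if_cong)
    ultimately show ?thesis by simp
  qed
  ultimately show ?case by (intro exI[of _ ?p]) blast
qed

lemma ppoly_imp_mpeval: "ppoly h d p \<Longrightarrow> \<exists>L. mpoly_degree_le d L \<and> p t = mpeval L"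
proof (induction rule: ppoly.induct)
  case (coeff c d)
  show ?case by (rule exI[of _ "[(c t, \<lambda>_. 0)]"]) (auto simp: mpoly_degree_le_def mpeval_def monom_at_zero)
next
  case (add d p q)
  then obtain L M where "mpoly_degree_le d L" "p t = mpeval L" "mpoly_degree_le d M" "q t = mpeval M" by blast
  then show ?case by (intro exI[of _ "L @ M"]) (auto simp: mpoly_degree_le_def mpeval_def)
next
  case (coord_mult d p i)
  then obtain L where L: "mpoly_degree_le d L" "p t = mpeval L" by blast
  let ?M = "map (\<lambda>(a, \<alpha>). (a, \<lambda>j. (if j = i then 1 else 0) + \<alpha> j)) L"
  have "mpoly_degree_le (Suc d) ?M" using L by (auto simp: mpoly_degree_le_def sum.distrib sum.delta)
  moreover have "mpeval ?M x = x $ i * mpeval L x" for x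
    unfolding mpeval_def using monom_at_single[of i 1 x]
    by (induction L) (auto simp: monom_at_add distrib_left)
  ultimately show ?case using L by (intro exI[of _ ?M]) auto
qed

section \<open>Quotients by powers of a positive coordinate\<close>

text \<open>The denominator exponent \<open>q\<close> and the numerator degree \<open>d\<close> are
  tracked separately: products add both, while differentiation in \<open>x\<close> raises
  \<open>q\<close> and keeps \<open>d\<close>. The coordinate \<open>\<rho>\<close> will be
  \<open>None\<close>, that is R.\<close>

definition qrat :: "real \<Rightarrow> 'o \<Rightarrow> nat \<Rightarrow> nat \<Rightarrow> (real \<Rightarrow> real ^ 'o::finite \<Rightarrow> real) \<Rightarrow> bool" where
  "qrat h \<rho> q d G \<longleftrightarrow>
    (\<exists>p. ppoly h d p \<and> (\<forall>t\<in>{0..h}. \<forall>x. x $ \<rho> > 0 \<longrightarrow> G t x = p t x / x $ \<rho> ^ q))"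

lemma qrat_cong:
  assumes "qrat h \<rho> q d G" "\<And>t x. t \<in> {0..h} \<Longrightarrow> x $ \<rho> > 0 \<Longrightarrow> G' t x = G t x"
  shows "qrat h \<rho> q d G'"
  using assms unfolding qrat_def by (metis (no_types, lifting))

lemma qrat_ppoly: "ppoly h d p \<Longrightarrow> qrat h \<rho> 0 d p"
  unfolding qrat_def by (intro exI[of _ p]) simp

lemma qrat_mono:
  assumes "qrat h \<rho> q d G" "q \<le> q'" "d + (q' - q) \<le> d'"
  shows "qrat h \<rho> q' d' G"
proof -
  obtain p where p: "ppoly h d p" "\<And>t x. t \<in> {0..h} \<Longrightarrow> x $ \<rho> > 0 \<Longrightarrow> G t x = p t x / x $ \<rho> ^ q"
    using assms(1) unfolding qrat_def by blast
  have "ppoly h d' (\<lambda>t x. p t x * x $ \<rho> ^ (q' - q))"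
    using ppoly_mono[OF ppoly_mult[OF p(1) ppoly_coord_power] assms(3)] .
  moreover have "G t x = p t x * x $ \<rho> ^ (q' - q) / x $ \<rho> ^ q'" if "t \<in> {0..h}" "x $ \<rho> > 0" for t x
    using p(2)[OF that] that assms(2) by (simp add: power_diff)
  ultimately show ?thesis unfolding qrat_def by blast
qed

lemma qrat_add:
  assumes "qrat h \<rho> q d G" "qrat h \<rho> q d G'"
  shows "qrat h \<rho> q d (\<lambda>t x. G t x + G' t x)"
proof -
  obtain p p' where "ppoly h d p" "\<forall>t\<in>{0..h}. \<forall>x. x $ \<rho> > 0 \<longrightarrow> G t x = p t x / x $ \<rho> ^ q"
    "ppoly h d p'" "\<forall>t\<in>{0..h}. \<forall>x. x $ \<rho> > 0 \<longrightarrow> G' t x = p' t x / x $ \<rho> ^ q"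
    using assms unfolding qrat_def by blast
  then show ?thesis unfolding qrat_def
    by (intro exI[of _ "\<lambda>t x. p t x + p' t x"]) (auto intro: ppoly.add simp: add_divide_distrib)
qed

lemma qrat_mult:
  assumes "qrat h \<rho> q d G" "qrat h \<rho> q' d' G'"
  shows "qrat h \<rho> (q + q') (d + d') (\<lambda>t x. G t x * G' t x)"
proof -
  obtain p p' where "ppoly h d p" "\<forall>t\<in>{0..h}. \<forall>x. x $ \<rho> > 0 \<longrightarrow> G t x = p t x / x $ \<rho> ^ q"
    "ppoly h d' p'" "\<forall>t\<in>{0..h}. \<forall>x. x $ \<rho> > 0 \<longrightarrow> G' t x = p' t x / x $ \<rho> ^ q'"
    using assms unfolding qrat_def by blast
  then show ?thesis unfolding qrat_def
    by (intro exI[of _ "\<lambda>t x. p t x * p' t x"]) (auto intro: ppoly_mult simp: power_add)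
qed

lemma qrat_cmult: "qrat h \<rho> q d G \<Longrightarrow> qrat h \<rho> q d (\<lambda>t x. c * G t x)"
  using qrat_mult[OF qrat_ppoly[OF ppoly.coeff[of h "\<lambda>_. c" 0]], of \<rho> q d G] by simp

lemma qrat_sum: "(\<And>a. a \<in> A \<Longrightarrow> qrat h \<rho> q d (G a)) \<Longrightarrow> qrat h \<rho> q d (\<lambda>t x. \<Sum>a\<in>A. G a t x)"
proof (induction A rule: infinite_finite_induct)
  case (insert a A)
  then show ?case using qrat_add[of h \<rho> q d "G a"] by simp
qed (auto intro!: exI[of _ "\<lambda>_ _. 0"] ppoly.coeff simp: qrat_def)

lemma qrat_divide_coord: "qrat h \<rho> q d G \<Longrightarrow> qrat h \<rho> (Suc q) d (\<lambda>t x. G t x / x $ \<rho>)"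
  unfolding qrat_def by (metis (no_types) divide_divide_eq_left power_Suc2)

lemma qrat_continuous:
  assumes "qrat h \<rho> q d G" "x $ \<rho> > 0"
  shows "continuous_on {0..h} (\<lambda>t. G t x)"
proof -
  obtain p where p: "ppoly h d p" "\<forall>t\<in>{0..h}. \<forall>x. x $ \<rho> > 0 \<longrightarrow> G t x = p t x / x $ \<rho> ^ q"
    using assms unfolding qrat_def by blast
  have "continuous_on {0..h} (\<lambda>t. p t x / x $ \<rho> ^ q)"
    using assms by (intro continuous_intros ppoly_continuous[OF p(1)]) auto
  then show ?thesis using p(2) assms(2) by (subst continuous_on_cong[OF refl]) auto
qed

lemma qrat_integral:
  assumes "qrat h \<rho> q d G"
  shows "qrat h \<rho> q d (\<lambda>t x. integral {0..t} (\<lambda>\<tau>. G \<tau> x))"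
proof -
  obtain p where p: "ppoly h d p" "\<forall>t\<in>{0..h}. \<forall>x. x $ \<rho> > 0 \<longrightarrow> G t x = p t x / x $ \<rho> ^ q"
    using assms unfolding qrat_def by blast
  obtain P where P: "ppoly h d P" "\<forall>t\<in>{0..h}. \<forall>x. P t x = integral {0..t} (\<lambda>\<tau>. p \<tau> x)"
    using ppoly_integral[OF p(1)] by blast
  have "integral {0..t} (\<lambda>\<tau>. G \<tau> x) = P t x / x $ \<rho> ^ q" if "t \<in> {0..h}" "x $ \<rho> > 0" for t x
  proof -
    have "integral {0..t} (\<lambda>\<tau>. G \<tau> x) = integral {0..t} (\<lambda>\<tau>. p \<tau> x / x $ \<rho> ^ q)"
      using p(2) that by (intro integral_cong) auto
    then show ?thesis using P(2) that by simp
  qed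
  then show ?thesis using P(1) unfolding qrat_def by blast
qed

definition partial_deriv ::
  "'o \<Rightarrow> (real \<Rightarrow> real ^ 'o::finite \<Rightarrow> 'v::real_normed_vector) \<Rightarrow> real \<Rightarrow> real ^ 'o \<Rightarrow> 'v" where
  "partial_deriv j G t x = frechet_derivative (G t) (at x) (axis j 1)"

lemma open_positive_coord: "open {x :: real ^ 'o::finite. x $ \<rho> > 0}"
  using open_halfspace_component_gt_cart by blast

lemma qrat_derivative:
  fixes G :: "real \<Rightarrow> real ^ 'o::finite \<Rightarrow> real"
  assumes "qrat h \<rho> q d G"
  shows "qrat h \<rho> (Suc q) d (partial_deriv j G)"
    and "t \<in> {0..h} \<Longrightarrow> x $ \<rho> > 0 \<Longrightarrow>
      (G t has_derivative (\<lambda>v. \<Sum>j\<in>UNIV. v $ j * partial_deriv j G t x)) (at x)"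
proof -
  obtain p where p: "ppoly h d p" "\<forall>t\<in>{0..h}. \<forall>x. x $ \<rho> > 0 \<longrightarrow> G t x = p t x / x $ \<rho> ^ q"
    using assms unfolding qrat_def by blast
  obtain p' where p': "\<And>j. ppoly h d (\<lambda>t x. x $ \<rho> * p' j t x)"
    "\<And>t x. (p t has_derivative (\<lambda>v. \<Sum>j\<in>UNIV. v $ j * p' j t x)) (at x)"
    using ppoly_derivative[OF p(1), of \<rho>] by blast
  \<comment> \<open>The numerator that the quotient rule gives for the partial derivative in
    direction \<open>j\<close>, over \<open>x $ \<rho> ^ Suc q\<close>.\<close>
  define N where "N = (\<lambda>j t x. x $ \<rho> * p' j t x + (if j = \<rho> then - real q else 0) * p t x)"
  have N: "ppoly h d (N j)" for j
    unfolding N_def by (intro ppoly.add p' ppoly_coeff_mult p continuous_intros)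
  have der: "(G t has_derivative (\<lambda>v. \<Sum>j\<in>UNIV. v $ j * (N j t x / x $ \<rho> ^ Suc q))) (at x)"
    if t: "t \<in> {0..h}" and x: "x $ \<rho> > 0" for t x
  proof -
    \<comment> \<open>For \<open>q = 0\<close> the exponent \<open>q - 1\<close> truncates to 0,
      harmlessly, since its term carries the factor \<open>q\<close>.\<close>
    have alg: "(y * S - real q * w * P) / y ^ Suc q
        = - P * (inverse (y ^ q) * (of_nat q * w * y ^ (q - 1)) * inverse (y ^ q)) + S / y ^ q"
      if "y \<noteq> 0" for y S w P :: real
      using that by (cases q) (auto simp: divide_simps algebra_simps)
    have 1: "((\<lambda>x. p t x / x $ \<rho> ^ q) has_derivative
      (\<lambda>v. - p t x * (inverse (x $ \<rho> ^ q) * (of_nat q * v $ \<rho> * x $ \<rho> ^ (q - 1)) * inverse (x $ \<rho> ^ q))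
        + (\<Sum>j\<in>UNIV. v $ j * p' j t x) / x $ \<rho> ^ q)) (at x)"
      using x by (intro has_derivative_divide[OF p'(2)] has_derivative_power
          bounded_linear.has_derivative[OF bounded_linear_vec_nth] has_derivative_ident) auto
    have "(\<lambda>v. - p t x * (inverse (x $ \<rho> ^ q) * (of_nat q * v $ \<rho> * x $ \<rho> ^ (q - 1)) * inverse (x $ \<rho> ^ q))
        + (\<Sum>j\<in>UNIV. v $ j * p' j t x) / x $ \<rho> ^ q)
      = (\<lambda>v. \<Sum>j\<in>UNIV. v $ j * (N j t x / x $ \<rho> ^ Suc q))"
    proof
      fix v :: "real ^ 'o"
      have "(\<Sum>j\<in>UNIV. v $ j * N j t x)
          = x $ \<rho> * (\<Sum>j\<in>UNIV. v $ j * p' j t x) - real q * v $ \<rho> * p t x"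
        by (simp add: N_def distrib_left sum.distrib sum_distrib_left mult.left_commute
            if_distrib[of "\<lambda>y. _ * y"] if_distrib[of "\<lambda>y. y * _"] sum.delta cong: if_cong)
      then have "(\<Sum>j\<in>UNIV. v $ j * (N j t x / x $ \<rho> ^ Suc q))
          = (x $ \<rho> * (\<Sum>j\<in>UNIV. v $ j * p' j t x) - real q * v $ \<rho> * p t x) / x $ \<rho> ^ Suc q"
        by (simp add: sum_divide_distrib[symmetric])
      also have "\<dots> = - p t x * (inverse (x $ \<rho> ^ q) * (of_nat q * v $ \<rho> * x $ \<rho> ^ (q - 1)) * inverse (x $ \<rho> ^ q))
        + (\<Sum>j\<in>UNIV. v $ j * p' j t x) / x $ \<rho> ^ q"
        using x by (intro alg) simp
      finally show "- p t x * (inverse (x $ \<rho> ^ q) * (of_nat q * v $ \<rho> * x $ \<rho> ^ (q - 1)) * inverse (x $ \<rho> ^ q))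
        + (\<Sum>j\<in>UNIV. v $ j * p' j t x) / x $ \<rho> ^ q = (\<Sum>j\<in>UNIV. v $ j * (N j t x / x $ \<rho> ^ Suc q))" by simp
    qed
    with 1 have "((\<lambda>x. p t x / x $ \<rho> ^ q) has_derivative
        (\<lambda>v. \<Sum>j\<in>UNIV. v $ j * (N j t x / x $ \<rho> ^ Suc q))) (at x)" by simp
    then show ?thesis
      by (rule has_derivative_transform_within_open[OF _ open_positive_coord[of \<rho>]]) (use p(2) t x in auto)
  qed
  have pd: "partial_deriv j G t x = N j t x / x $ \<rho> ^ Suc q" if "t \<in> {0..h}" "x $ \<rho> > 0" for j t x
    unfolding partial_deriv_def frechet_derivative_at[OF der[OF that], symmetric]
    by (simp add: axis_def if_distrib[of "\<lambda>y. y * _"] if_distrib[of "\<lambda>y. y / _"] sum.delta cong: if_cong)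
  show "qrat h \<rho> (Suc q) d (partial_deriv j G)"
    unfolding qrat_def using N pd by blast
  show "(G t has_derivative (\<lambda>v. \<Sum>j\<in>UNIV. v $ j * partial_deriv j G t x)) (at x)"
    if "t \<in> {0..h}" "x $ \<rho> > 0" for t x
    using der[OF that] pd[OF that] by simp
qed

section \<open>Vector fields with such components\<close>

definition vqrat ::
  "real \<Rightarrow> 'o \<Rightarrow> nat \<Rightarrow> nat \<Rightarrow> (real \<Rightarrow> real ^ 'o::finite \<Rightarrow> real ^ 'o) \<Rightarrow> bool" where
  "vqrat h \<rho> q d F \<longleftrightarrow> (\<forall>i. qrat h \<rho> q d (\<lambda>t x. F t x $ i))"

lemma vqrat_cong:
  assumes "vqrat h \<rho> q d F" "\<And>t x. t \<in> {0..h} \<Longrightarrow> x $ \<rho> > 0 \<Longrightarrow> F' t x = F t x"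
  shows "vqrat h \<rho> q d F'"
  unfolding vqrat_def
proof
  fix i
  show "qrat h \<rho> q d (\<lambda>t x. F' t x $ i)"
    by (rule qrat_cong[of h \<rho> q d "\<lambda>t x. F t x $ i"]) (use assms in \<open>simp_all add: vqrat_def\<close>)
qed

lemma vqrat_add: "vqrat h \<rho> q d F \<Longrightarrow> vqrat h \<rho> q d F' \<Longrightarrow> vqrat h \<rho> q d (\<lambda>t x. F t x + F' t x)"
  unfolding vqrat_def by (auto intro: qrat_add)

lemma vqrat_sum: "(\<And>a. a \<in> A \<Longrightarrow> vqrat h \<rho> q d (F a)) \<Longrightarrow> vqrat h \<rho> q d (\<lambda>t x. \<Sum>a\<in>A. F a t x)"
  unfolding vqrat_def by (auto intro!: qrat_sum)

lemma vqrat_cmult: "vqrat h \<rho> q d F \<Longrightarrow> vqrat h \<rho> q d (\<lambda>t x. c *\<^sub>R F t x)"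
  unfolding vqrat_def by (auto intro: qrat_cmult)

lemma vqrat_scaleR:
  "qrat h \<rho> q d G \<Longrightarrow> vqrat h \<rho> q' d' F \<Longrightarrow> vqrat h \<rho> (q + q') (d + d') (\<lambda>t x. G t x *\<^sub>R F t x)"
  unfolding vqrat_def by (auto intro: qrat_mult)

lemma vqrat_integral:
  fixes F :: "real \<Rightarrow> real ^ 'o::finite \<Rightarrow> real ^ 'o"
  assumes "vqrat h \<rho> q d F"
  shows "vqrat h \<rho> q d (\<lambda>t x. integral {0..t} (\<lambda>\<tau>. F \<tau> x))"
  unfolding vqrat_def
proof
  fix i
  show "qrat h \<rho> q d (\<lambda>t x. integral {0..t} (\<lambda>\<tau>. F \<tau> x) $ i)"
  proof (rule qrat_cong)
    show "qrat h \<rho> q d (\<lambda>t x. integral {0..t} (\<lambda>\<tau>. F \<tau> x $ i))"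
      using assms qrat_integral unfolding vqrat_def by blast
    fix t and x :: "real ^ 'o" assume tx: "t \<in> {0..h}" "x $ \<rho> > 0"
    have "continuous_on {0..h} (\<lambda>\<tau>. \<chi> i. F \<tau> x $ i)"
      using assms tx unfolding vqrat_def by (intro continuous_on_vec_lambda qrat_continuous) auto
    then have "(\<lambda>\<tau>. F \<tau> x) integrable_on {0..t}"
      using tx by (auto intro!: integrable_continuous_real intro: continuous_on_subset)
    then show "integral {0..t} (\<lambda>\<tau>. F \<tau> x) $ i = integral {0..t} (\<lambda>\<tau>. F \<tau> x $ i)" by simp
  qed
qed

lemma vqrat_derivative:
  assumes "vqrat h \<rho> q d F"
  shows "vqrat h \<rho> (Suc q) d (partial_deriv j F)"
    and "t \<in> {0..h} \<Longrightarrow> x $ \<rho> > 0 \<Longrightarrow>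
      (F t has_derivative (\<lambda>v. \<Sum>j\<in>UNIV. v $ j *\<^sub>R partial_deriv j F t x)) (at x)"
proof -
  let ?F = "\<lambda>i t x. F t x $ i"
  have F: "qrat h \<rho> q d (?F i)" for i using assms by (simp add: vqrat_def)
  have der: "(F t has_derivative (\<lambda>v. \<chi> i. \<Sum>j\<in>UNIV. v $ j * partial_deriv j (?F i) t x)) (at x)"
    if "t \<in> {0..h}" "x $ \<rho> > 0" for t x
    using has_derivative_vec_lambda[of "\<lambda>i x. F t x $ i", OF qrat_derivative(2)[OF F that]] by simp
  have pd: "partial_deriv j F t x $ i = partial_deriv j (?F i) t x"
    if "t \<in> {0..h}" "x $ \<rho> > 0" for j t x i
    unfolding partial_deriv_def[of j F] frechet_derivative_at[OF der[OF that], symmetric]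
    by (simp add: axis_def if_distrib[of "\<lambda>y. y * _"] sum.delta cong: if_cong)
  show "vqrat h \<rho> (Suc q) d (partial_deriv j F)"
    unfolding vqrat_def using qrat_cong[OF qrat_derivative(1)[OF F] pd] by blast
  show "(F t has_derivative (\<lambda>v. \<Sum>j\<in>UNIV. v $ j *\<^sub>R partial_deriv j F t x)) (at x)"
    if "t \<in> {0..h}" "x $ \<rho> > 0" for t x
  proof -
    have "(\<lambda>v. \<chi> i. \<Sum>j\<in>UNIV. v $ j * partial_deriv j (?F i) t x)
        = (\<lambda>v. \<Sum>j\<in>UNIV. v $ j *\<^sub>R partial_deriv j F t x)"
      by (simp add: fun_eq_iff vec_eq_iff pd[OF that])
    then show ?thesis using der[OF that] by simp
  qed
qed

section \<open>Iterated Frechet derivatives in coordinates\<close>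

text \<open>The multilinear form with coefficients \<open>H J\<close>: the sum over all index lists
  \<open>J\<close> as long as the list of vectors, each \<open>H J\<close> weighted by the product
  of the matching coordinates. With index lists the order of the form may vary.\<close>

primrec multilinear_sum ::
  "(real ^ 'o::finite) list \<Rightarrow> ('o list \<Rightarrow> 'v::real_normed_vector) \<Rightarrow> 'v" where
  "multilinear_sum [] H = H []"
| "multilinear_sum (v # vs) H = (\<Sum>j\<in>UNIV. v $ j *\<^sub>R multilinear_sum vs (\<lambda>J. H (j # J)))"

lemma multilinear_sum_linear:
  "multilinear_sum vs (\<lambda>J. \<Sum>j\<in>A. c j *\<^sub>R H j J) = (\<Sum>j\<in>A. c j *\<^sub>R multilinear_sum vs (H j))"
proof (induction vs arbitrary: H)
  case (Cons v vs)
  then show ?case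
    by (simp add: scaleR_sum_right sum.swap[of _ A] mult.commute)
qed simp

lemma multilinear_sum_has_derivative:
  "(\<And>J. (H J has_derivative H' J) F) \<Longrightarrow>
    ((\<lambda>x. multilinear_sum vs (\<lambda>J. H J x)) has_derivative (\<lambda>w. multilinear_sum vs (\<lambda>J. H' J w))) F"
  by (induction vs arbitrary: H H') (auto intro!: has_derivative_sum has_derivative_scaleR_right)

lemma vqrat_iterated_partials:
  "vqrat h \<rho> q d F \<Longrightarrow> vqrat h \<rho> (q + length J) d (foldr partial_deriv J F)"
  by (induction J) (auto intro: vqrat_derivative(1))

text \<open>The vectors \<open>vs\<close> are constant in each differentiation, so only the
  coefficients are differentiated. The induction hypothesis holds near \<open>x\<close> because the
  half space is open.\<close>

lemma iter_frechet_eq_multilinear_sum: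
  assumes F: "vqrat h \<rho> q d F" and t: "t \<in> {0..h}" and "x $ \<rho> > 0"
  shows "iter_frechet (F t) vs x = multilinear_sum vs (\<lambda>J. foldr partial_deriv J F t x)"
  using \<open>x $ \<rho> > 0\<close>
proof (induction vs arbitrary: x)
  case (Cons v vs)
  let ?D = "\<lambda>w. multilinear_sum vs (\<lambda>J. \<Sum>j\<in>UNIV. w $ j *\<^sub>R foldr partial_deriv (j # J) F t x)"
  have "((\<lambda>x. multilinear_sum vs (\<lambda>J. foldr partial_deriv J F t x)) has_derivative ?D) (at x)"
    using vqrat_derivative(2)[OF vqrat_iterated_partials[OF F] t Cons.prems]
    by (intro multilinear_sum_has_derivative) simp
  then have "(iter_frechet (F t) vs has_derivative ?D) (at x)"
    by (rule has_derivative_transform_within_open[OF _ open_positive_coord[of \<rho>]]) (use Cons in auto)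
  from frechet_derivative_at[OF this] show ?case
    by (simp add: multilinear_sum_linear[symmetric] fun_eq_iff)
qed simp

lemma vqrat_multilinear_sum:
  assumes "\<And>J. length J = length js \<Longrightarrow> vqrat h \<rho> q d (H J)"
    and "\<And>j. j \<in> set js \<Longrightarrow> vqrat h \<rho> (j - 1) (j * m) (y j)"
  shows "vqrat h \<rho> (q + (\<Sum>j\<leftarrow>js. j - 1)) (d + sum_list js * m)
    (\<lambda>t x. multilinear_sum (map (\<lambda>j. y j t x) js) (\<lambda>J. H J t x))"
  using assms
proof (induction js arbitrary: H)
  case (Cons a js)
  have "vqrat h \<rho> ((a - 1) + (q + (\<Sum>j\<leftarrow>js. j - 1))) (a * m + (d + sum_list js * m))
      (\<lambda>t x. y a t x $ i *\<^sub>R multilinear_sum (map (\<lambda>j. y j t x) js) (\<lambda>J. H (i # J) t x))" for i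
    using Cons.prems by (intro vqrat_scaleR Cons.IH) (auto simp: vqrat_def)
  then show ?case by (auto intro!: vqrat_sum simp: add_ac distrib_right)
qed simp

text \<open>In the term of a tuple with sum \<open>l\<close> and \<open>L\<close> entries, the
  denominator exponent is \<open>i - l - 1\<close> from \<open>F (i - l)\<close>, plus
  \<open>L\<close> from differentiating, plus \<open>l - L\<close> from the \<open>y\<close>
  factors, in total \<open>i - 1\<close>. The numerator degree is
  \<open>(i - l) * m + l * m = i * m\<close>.\<close>

lemma avg_y_vqrat:
  assumes F: "\<And>i. i \<ge> 1 \<Longrightarrow> vqrat h \<rho> (i - 1) (i * m) (F i)" and "i \<ge> 1"
  shows "vqrat h \<rho> (i - 1) (i * m) (avg_y F i)"
  using \<open>i \<ge> 1\<close>
proof (induction i rule: less_induct)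
  case (less i)
  \<comment> \<open>The orders of the \<open>y\<close> factors, each \<open>j\<close> repeated
    \<open>\<beta> j\<close> times: \<open>L\<close> entries with sum \<open>l\<close>.\<close>
  define js where "js = (\<lambda>l \<beta>. concat (map (\<lambda>j. replicate (\<beta> j) j) [1..<Suc l]))"
  let ?coef = "\<lambda>l (\<beta> :: nat \<Rightarrow> nat). 1 / (\<Prod>j=1..l. fact (\<beta> j) * fact j ^ \<beta> j) :: real"
  let ?T = "\<lambda>l \<beta> \<tau> \<eta>. iter_frechet (F (i - l) \<tau>) (map (\<lambda>j. avg_y F j \<tau> \<eta>) (js l \<beta>)) \<eta>"
  have list: "concat (map (\<lambda>j. replicate (\<beta> j) (avg_y F j \<tau> \<eta>)) [1..<Suc l]) = map (\<lambda>j. avg_y F j \<tau> \<eta>) (js l \<beta>)"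
    for l \<beta> \<tau> \<eta> by (simp add: js_def map_concat o_def del: upt_Suc)
  have T: "vqrat h \<rho> (i - 1) (i * m) (?T l \<beta>)" if l: "l \<in> {1..i - 1}" and \<beta>: "\<beta> \<in> avg_tuples l" for l \<beta>
  proof -
    have set: "set (js l \<beta>) \<subseteq> {1..l}" by (auto simp: js_def simp del: upt_Suc)
    have "sum_list (concat (map (\<lambda>j. replicate (\<beta> j) j) xs)) = (\<Sum>j\<leftarrow>xs. j * \<beta> j)" for xs
      by (induction xs) (simp_all add: sum_list_replicate mult.commute)
    then have "sum_list (js l \<beta>) = (\<Sum>j\<leftarrow>[1..<Suc l]. j * \<beta> j)"
      unfolding js_def by blast
    also have "\<dots> = (\<Sum>j=1..l. j * \<beta> j)"
      by (simp add: interv_sum_list_conv_sum_set_nat atLeastLessThanSuc_atLeastAtMost del: upt_Suc)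
    finally have sum: "sum_list (js l \<beta>) = l" using \<beta> by (simp add: avg_tuples_def)
    have len: "length xs + (\<Sum>j\<leftarrow>xs. j - 1) = sum_list xs" if "set xs \<subseteq> {1..l}" for xs :: "nat list"
      using that by (induction xs) auto
    have Fl: "vqrat h \<rho> (i - l - 1) ((i - l) * m) (F (i - l))"
      using l by (intro F) (simp, arith)
    have "vqrat h \<rho> (i - l - 1 + length (js l \<beta>) + (\<Sum>j\<leftarrow>js l \<beta>. j - 1)) ((i - l) * m + sum_list (js l \<beta>) * m)
        (\<lambda>\<tau> \<eta>. multilinear_sum (map (\<lambda>j. avg_y F j \<tau> \<eta>) (js l \<beta>)) (\<lambda>J. foldr partial_deriv J (F (i - l)) \<tau> \<eta>))"
    proof (rule vqrat_multilinear_sum)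
      show "vqrat h \<rho> (i - l - 1 + length (js l \<beta>)) ((i - l) * m) (foldr partial_deriv J (F (i - l)))"
        if "length J = length (js l \<beta>)" for J
        using vqrat_iterated_partials[OF Fl, of J] that by simp
      show "vqrat h \<rho> (j - 1) (j * m) (avg_y F j)" if "j \<in> set (js l \<beta>)" for j
        using less.IH[of j] that set l by fastforce
    qed
    moreover have "i - l - 1 + length (js l \<beta>) + (\<Sum>j\<leftarrow>js l \<beta>. j - 1) = i - 1"
      using len[OF set] sum l unfolding atLeastAtMost_iff by linarith
    moreover have "(i - l) + l = i" using l by auto
    then have "(i - l) * m + sum_list (js l \<beta>) * m = i * m"
      unfolding sum by (metis distrib_right)
    ultimately show ?thesis
      using iter_frechet_eq_multilinear_sum[OF Fl] by (auto intro: vqrat_cong)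
  qed
  have "vqrat h \<rho> (i - 1) (i * m) (\<lambda>\<theta> \<eta>. fact i *\<^sub>R integral {0..\<theta>} (\<lambda>\<tau>. F i \<tau> \<eta> +
     (\<Sum>l\<in>{1..i - 1}. \<Sum>\<beta>\<in>avg_tuples l. ?coef l \<beta> *\<^sub>R ?T l \<beta> \<tau> \<eta>)))"
    using F[OF less.prems] T by (intro vqrat_cmult vqrat_integral vqrat_add vqrat_sum) auto
  then show ?case
    by (rule vqrat_cong) (subst avg_y.simps, simp only: list)
qed

section \<open>The averaged functions\<close>

lemma fps_nth_eq_deriv:
  fixes f :: "'a::{banach, real_normed_field} \<Rightarrow> 'a"
  assumes "f has_fps_expansion A"
  shows "fps_nth A n = (deriv ^^ n) f 0 / fact n"
proof -
  have "(deriv ^^ n) f has_fps_expansion (fps_deriv ^^ n) A"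
    by (induction n) (auto intro: assms has_fps_expansion_deriv)
  then have "(deriv ^^ n) f 0 = fps_nth ((fps_deriv ^^ n) A) 0"
    by (auto simp: has_fps_expansion_def eval_fps_at_0 dest: eventually_nhds_x_imp_x)
  then show ?thesis by (simp add: fps_0th_higher_deriv)
qed

text \<open>Compare the coefficients of \<open>\<epsilon> ^ i\<close> in numerator = denominator *
  quotient, read as formal power series. The case distinctions at \<open>k\<close> reflect that both
  given sums stop there.\<close>

lemma taylor_coeff_quotient_recurrence:
  fixes a \<beta> :: "nat \<Rightarrow> real" and r \<beta>0 :: real and k :: nat
  defines "f \<equiv> \<lambda>\<epsilon>. r * (\<Sum>i=1..k. \<epsilon> ^ i * a i) / (\<beta>0 + (\<Sum>i=1..k. \<epsilon> ^ i * \<beta> i))"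
  defines "c \<equiv> \<lambda>i. (deriv ^^ i) f 0 / fact i"
  assumes "\<beta>0 \<noteq> 0" and "i \<ge> 1"
  shows "\<beta>0 * c i = (if i \<le> k then r * a i else 0)
    - (\<Sum>l\<in>{1..<i}. (if l \<le> k then \<beta> l else 0) * c (i - l))"
proof -
  define N where "N = fps_const r * (\<Sum>i=1..k. fps_X ^ i * fps_const (a i))"
  define D where "D = fps_const \<beta>0 + (\<Sum>i=1..k. fps_X ^ i * fps_const (\<beta> i))"
  have nth: "fps_nth (fps_X ^ i * fps_const c) n = (if i = n then c else 0)" for i n and c :: real
    by (simp add: fps_mult_right_const_nth)
  have Dn: "fps_nth D n = (if n = 0 then \<beta>0 else if n \<le> k then \<beta> n else 0)" for n
    unfolding D_def fps_add_nth fps_sum_nth nth by (auto simp: sum.delta')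
  have Nn: "fps_nth N n = (if 1 \<le> n \<and> n \<le> k then r * a n else 0)" for n
    unfolding N_def fps_mult_left_const_nth fps_sum_nth nth by (auto simp: sum.delta')
  have D0: "fps_nth D 0 \<noteq> 0" using Dn assms by simp
  have "f has_fps_expansion N * inverse D"
    unfolding f_def divide_inverse using D0 unfolding N_def D_def
    by (intro has_fps_expansion_mult has_fps_expansion_inverse has_fps_expansion_add
        has_fps_expansion_const has_fps_expansion_sum has_fps_expansion_fps_X_power)
  then have c: "c n = fps_nth (N * inverse D) n" for n
    by (simp add: c_def fps_nth_eq_deriv)
  have "N = D * (N * inverse D)" using inverse_mult_eq_1'[OF D0] by (simp add: ac_simps)
  then have "fps_nth N i = (\<Sum>l=0..i. fps_nth D l * c (i - l))"
    unfolding c by (metis fps_mult_nth)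
  also have "\<dots> = \<beta>0 * c i + (\<Sum>l=1..i. fps_nth D l * c (i - l))"
    by (subst sum.atLeast_Suc_atMost) (auto simp: Dn)
  also have "(\<Sum>l=1..i. fps_nth D l * c (i - l)) = (\<Sum>l\<in>{1..<i}. fps_nth D l * c (i - l)) + fps_nth D i * c 0"
    using \<open>i \<ge> 1\<close> by (subst sum.last_plus) (auto simp: add.commute)
  \<comment> \<open>The numerator has no constant term, so the summand \<open>l = i\<close> drops
    out.\<close>
  also have "c 0 = 0" by (simp add: c fps_mult_nth Nn)
  also have "(\<Sum>l\<in>{1..<i}. fps_nth D l * c (i - l))
      = (\<Sum>l\<in>{1..<i}. (if l \<le> k then \<beta> l else 0) * c (i - l))"
    by (rule sum.cong) (auto simp: Dn)
  finally show ?thesis using \<open>i \<ge> 1\<close> by (simp add: Nn)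
qed

lemma ppoly_cyl_monom:
  assumes "e \<in> expos m"
  shows "ppoly h m (cyl_monom (e :: 's::finite expo))"
proof -
  obtain i1 i2 e' where e: "e = (i1, i2, e')" by (cases e)
  have "ppoly h (i1 + i2 + (\<Sum>s\<in>UNIV. e' s)) (\<lambda>\<theta> \<eta>. (cos \<theta> ^ i1 * sin \<theta> ^ i2) *
      (\<eta> $ None ^ i1 * \<eta> $ None ^ i2 * (\<Prod>s\<in>UNIV. (\<eta> $ Some s) ^ e' s)))"
    by (intro ppoly_coeff_mult ppoly_mult ppoly_coord_power ppoly_prod continuous_intros) auto
  moreover have "i1 + i2 + (\<Sum>s\<in>UNIV. e' s) = m" using assms by (simp add: e expos_def)
  moreover have "cyl_monom e = (\<lambda>\<theta> \<eta>. (cos \<theta> ^ i1 * sin \<theta> ^ i2) *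
      (\<eta> $ None ^ i1 * \<eta> $ None ^ i2 * (\<Prod>s\<in>UNIV. (\<eta> $ Some s) ^ e' s)))"
    by (simp add: fun_eq_iff e cyl_monom_def power_mult_distrib ac_simps)
  ultimately show ?thesis by simp
qed

lemma ppoly_S:
  fixes P :: "'s::finite params"
  assumes "m \<ge> 1"
  shows "ppoly h m (S1 P m i)" "ppoly h m (S2 P m i)" "ppoly h m (Ss P m s i)"
proof -
  have lin: "ppoly h m (\<lambda>\<theta> \<eta> :: real ^ 's option. c * \<eta> $ j)" for c j
    using ppoly_mono[OF ppoly_coeff_mult[OF ppoly_coord continuous_on_const]] assms by simp
  show "ppoly h m (S1 P m i)" "ppoly h m (S2 P m i)" "ppoly h m (Ss P m s i)"
    unfolding S1_def[abs_def] S2_def[abs_def] Ss_def[abs_def]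
    by (intro ppoly.add lin ppoly_sum ppoly_coeff_mult ppoly_cyl_monom continuous_intros; assumption)+
qed

text \<open>Solved for the coefficient of order \<open>i\<close>, the recurrence divides by b R. The
  factor R of the numerator cancels in the first term; in the others, passing from
  \<open>F (i - l)\<close> to \<open>F i\<close> costs one power of R in the denominator and a
  factor of degree \<open>m\<close>.\<close>

lemma std_F_vqrat:
  fixes P :: "'s::finite params"
  assumes b: "par_b P \<noteq> 0" and m: "m \<ge> 1" and "i \<ge> 1"
  shows "vqrat h None (i - 1) (i * m) (std_F P m k i)"
  using \<open>i \<ge> 1\<close>
proof (induction i rule: less_induct)
  case (less i)
  define A where "A = (\<lambda>j i. case j of None \<Rightarrow> S1 P m i | Some s \<Rightarrow> Ss P m s i)"
  show ?case unfolding vqrat_def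
  proof
    fix j
    let ?G = "\<lambda>\<theta> \<eta>. (if i \<le> k then 1 / par_b P else 0) * A j i \<theta> \<eta>
      + (\<Sum>l\<in>{1..<i}. (if l \<le> k then - 1 / par_b P else 0) * ((S2 P m l \<theta> \<eta> * std_F P m k (i - l) \<theta> \<eta> $ j) / \<eta> $ None))"
    show "qrat h None (i - 1) (i * m) (\<lambda>\<theta> \<eta>. std_F P m k i \<theta> \<eta> $ j)"
    proof (rule qrat_cong[where G = ?G])
      have "ppoly h m (A j i)" unfolding A_def by (cases j) (use ppoly_S[OF m] in auto)
      moreover have "m + (i - 1 - 0) \<le> i * m"
        using less.prems m by (cases i) (auto simp: algebra_simps)
      ultimately have A: "qrat h None (i - 1) (i * m) (A j i)"
        by (intro qrat_mono[OF qrat_ppoly]) auto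
      have "qrat h None (i - 1) (i * m)
          (\<lambda>\<theta> \<eta>. (S2 P m l \<theta> \<eta> * std_F P m k (i - l) \<theta> \<eta> $ j) / \<eta> $ None)" if l: "l \<in> {1..<i}" for l
      proof (rule qrat_mono)
        have "qrat h None (i - l - 1) ((i - l) * m) (\<lambda>\<theta> \<eta>. std_F P m k (i - l) \<theta> \<eta> $ j)"
          using less.IH[of "i - l"] l unfolding vqrat_def by fastforce
        from qrat_divide_coord[OF qrat_mult[OF qrat_ppoly[OF ppoly_S(2)[OF m]] this]]
        show "qrat h None (Suc (0 + (i - l - 1))) (m + (i - l) * m)
          (\<lambda>\<theta> \<eta>. (S2 P m l \<theta> \<eta> * std_F P m k (i - l) \<theta> \<eta> $ j) / \<eta> $ None)" .
        show "Suc (0 + (i - l - 1)) \<le> i - 1" using l by auto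
        obtain l' where l': "l = Suc l'" using l by (cases l) auto
        obtain i' where i': "i = l + i'" "i' \<ge> 1" using l that[of "i - l"] by auto
        \<comment> \<open>Raising the denominator exponent from \<open>i - l\<close> to
          \<open>i - 1\<close> adds \<open>l - 1\<close> to the numerator degree, and the available
          slack is \<open>(l - 1) * m\<close>.\<close>
        have "l' \<le> l' * m" using m by simp
        then show "m + (i - l) * m + (i - 1 - Suc (0 + (i - l - 1))) \<le> i * m"
          using i' by (simp add: l' algebra_simps)
      qed
      then show "qrat h None (i - 1) (i * m) ?G"
        using A by (intro qrat_add qrat_sum qrat_cmult)
      fix \<theta> and \<eta> :: "real ^ 's option" assume R: "\<eta> $ None > 0"
      let ?c = "\<lambda>n. std_F P m k n \<theta> \<eta> $ j"
      have c: "?c n = (deriv ^^ n) (\<lambda>\<epsilon>. \<eta> $ None * (\<Sum>i=1..k. \<epsilon> ^ i * A j i \<theta> \<eta>)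
          / (par_b P * \<eta> $ None + (\<Sum>i=1..k. \<epsilon> ^ i * S2 P m i \<theta> \<eta>))) 0 / fact n" for n
        by (cases j) (simp_all add: std_F_def std_rhs_def A_def)
      have b': "par_b P * \<eta> $ None \<noteq> 0" using b R by simp
      have "par_b P * \<eta> $ None * ?c i = (if i \<le> k then \<eta> $ None * A j i \<theta> \<eta> else 0)
        - (\<Sum>l\<in>{1..<i}. (if l \<le> k then S2 P m l \<theta> \<eta> else 0) * ?c (i - l))"
        unfolding c by (rule taylor_coeff_quotient_recurrence[OF b' less.prems])
      then have "?c i = ((if i \<le> k then \<eta> $ None * A j i \<theta> \<eta> else 0)
        - (\<Sum>l\<in>{1..<i}. (if l \<le> k then S2 P m l \<theta> \<eta> else 0) * ?c (i - l))) / (par_b P * \<eta> $ None)"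
        using b' by (simp add: field_simps)
      also have "\<dots> = (if i \<le> k then 1 / par_b P else 0) * A j i \<theta> \<eta>
        - (\<Sum>l\<in>{1..<i}. (if l \<le> k then S2 P m l \<theta> \<eta> else 0) * ?c (i - l) / (par_b P * \<eta> $ None))"
        using R by (simp add: diff_divide_distrib sum_divide_distrib)
      also have "\<dots> = ?G \<theta> \<eta>"
        unfolding diff_conv_add_uminus sum_negf[symmetric]
        by (intro arg_cong2[where f = "(+)"] refl sum.cong) auto
      finally show "?c i = ?G \<theta> \<eta>" .
    qed
  qed
qed

section \<open>Counting simple zeros of the averaged function\<close>

text \<open>Multiplying by the power \<open>k - 1\<close> of R turns the averaged function into a
  polynomial map of degree at most \<open>k * m\<close> with the same zeros for R > 0, and simple
  zeros stay nondegenerate.\<close>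

lemma finite_simple_zeros:
  fixes P :: "'s::finite params"
  assumes b: "par_b P \<noteq> 0" and m: "m \<ge> 1" and k: "k \<ge> 1"
  shows "finite (simple_zeros m k P) \<and> card (simple_zeros m k P) \<le> (k * m) ^ CARD('s option)"
proof -
  define f where "f = avg_f P m k k"
  have V: "vqrat (2 * pi) None (k - 1) (k * m) (\<lambda>\<theta> \<eta>. avg_y (std_F P m k) k \<theta> \<eta> /\<^sub>R fact k)"
    using vqrat_cmult[OF avg_y_vqrat[OF std_F_vqrat[OF b m] k]] .
  have "\<exists>L. mpoly_degree_le (k * m) L \<and> (\<forall>\<eta>. \<eta> $ None > 0 \<longrightarrow> f \<eta> $ j = mpeval L \<eta> / \<eta> $ None ^ (k - 1))" for j
  proof -
    obtain p where p: "ppoly (2 * pi) (k * m) p" "\<forall>t\<in>{0..2 * pi}. \<forall>\<eta>. \<eta> $ None > 0 \<longrightarrow>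
        (avg_y (std_F P m k) k t \<eta> /\<^sub>R fact k) $ j = p t \<eta> / \<eta> $ None ^ (k - 1)"
      using V unfolding vqrat_def qrat_def by blast
    obtain L where "mpoly_degree_le (k * m) L" "p (2 * pi) = mpeval L" using ppoly_imp_mpeval[OF p(1)] by blast
    then show ?thesis using p(2) by (intro exI[of _ L]) (auto simp: f_def avg_f_def)
  qed
  then obtain L where L: "\<And>j. mpoly_degree_le (k * m) (L j)"
    "\<And>j \<eta>. \<eta> $ None > 0 \<Longrightarrow> f \<eta> $ j = mpeval (L j) \<eta> / \<eta> $ None ^ (k - 1)"
    by metis
  define G where "G = (\<lambda>x. \<chi> i. mpeval (L i) x)"
  have G: "G \<eta> = \<eta> $ None ^ (k - 1) *\<^sub>R f \<eta>" if "\<eta> $ None > 0" for \<eta>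
    using L(2)[OF that] that by (simp add: G_def vec_eq_iff)
  have "G z = 0 \<and> (\<exists>G'. (G has_derivative G') (at z) \<and> inj G')" if z: "z \<in> simple_zeros m k P" for z
  proof -
    have z: "z $ None > 0" "f z = 0" "det (jacobian f (at z)) \<noteq> 0"
      using z by (auto simp: simple_zeros_def f_def)
    \<comment> \<open>A nonzero determinant of \<open>jacobian\<close> does not by itself give
      differentiability; this comes from the rational form, used at the endpoint
      \<open>2 * pi\<close>.\<close>
    have "f differentiable (at z)"
      using vqrat_derivative(2)[OF V, of "2 * pi" z] z(1)
      unfolding f_def avg_f_def[abs_def] differentiable_def by auto
    then have f': "(f has_derivative (\<lambda>v. jacobian f (at z) *v v)) (at z)"
      using jacobian_works by blast
    have "((\<lambda>x. x $ None ^ (k - 1)) has_derivative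
        (\<lambda>v. of_nat (k - 1) * v $ None * z $ None ^ (k - 1 - 1))) (at z)"
      by (intro has_derivative_power bounded_linear.has_derivative[OF bounded_linear_vec_nth] has_derivative_ident)
    \<comment> \<open>The product rule term that differentiates the power of R contains
      \<open>f z\<close>, which is zero.\<close>
    from has_derivative_scaleR[OF this f']
    have "((\<lambda>x. x $ None ^ (k - 1) *\<^sub>R f x) has_derivative
        (\<lambda>v. z $ None ^ (k - 1) *\<^sub>R (jacobian f (at z) *v v))) (at z)" using z(2) by simp
    then have "(G has_derivative (\<lambda>v. z $ None ^ (k - 1) *\<^sub>R (jacobian f (at z) *v v))) (at z)"
      by (rule has_derivative_transform_within_open[OF _ open_positive_coord[of None]]) (use z G in auto)
    moreover have "inj (\<lambda>v. z $ None ^ (k - 1) *\<^sub>R (jacobian f (at z) *v v))"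
    proof (rule injI)
      fix v w assume "z $ None ^ (k - 1) *\<^sub>R (jacobian f (at z) *v v) = z $ None ^ (k - 1) *\<^sub>R (jacobian f (at z) *v w)"
      then have "jacobian f (at z) *v v = jacobian f (at z) *v w" using z(1) by simp
      then show "v = w" using z(3) inj_matrix_vector_mult[of "jacobian f (at z)"]
        by (auto simp: invertible_det_nz inj_def)
    qed
    ultimately show ?thesis using G[OF z(1)] z(2) by auto
  qed
  then show ?thesis
    using bezout_nondegenerate_zeros[of "k * m" L "simple_zeros m k P"] L(1) unfolding G_def by blast
qed

theorem corollary1:
  fixes n m k :: nat
  assumes "n \<ge> 3" and "CARD('s::finite) = n - 2"
    and "m \<ge> 2" and "k \<ge> 1"
  shows "H_avg TYPE('s) m k \<le> enat ((k * m) ^ (n - 1))"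
proof -
  have "CARD('s option) = n - 1" using assms by (simp add: card_UNIV_option)
  then show ?thesis
    unfolding H_avg_def avg_admissible_def enat_card_def
    using finite_simple_zeros[where ?'s = 's, of _ m k] assms by (auto intro!: SUP_least)
qed

end
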